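(* Let $m\ge2$, let $\alpha_1,\dots,\alpha_m\ge2$ be integers, and let $\mathcal R$ be the refined quiver resultant of $C=\mathrm{diag}(\alpha_1,\dots,\alpha_m)$. Let $p+q=m$. For $I=\{i_1,\dots,i_p\}$ and $K=\{k_1,\dots,k_q\}$ with $I\sqcup K=\{1,\dots,m\}$ define $$\varphi_{I,K}:=\Big(a_0\prod_{i\in I}b_{i,1}\Big)^{\prod_{k\in K}(\alpha_k-1)}\prod_{k\in K}b_{k,2}^{\prod'_{k'\in K,\,k'\neq k}(\alpha_{k'}-1)}+(-1)^{1+\sum_{k\in K}\prod_{k'\in K,\,k'\ne k}(\alpha_{k'}-1)}\Big(a_1\prod_{i\in I}b_{i,0}\Big)^{\prod_{k\in K}(\alpha_k-1)}\prod_{k\in K}b_{k,1}^{\prod'_{k'\in K,\,k'\neq k}(\alpha_{k'}-1)},$$ where the product $\prod'$ equals $1$ if $q=1$. Then $$\phi_{p,q}:=\mu_{p,q}\cdot\prod_{\substack{I,K\subset\{1,\dots,m\}\\|I|=p,\ |K|=q}}\mathrm{GCD}(\varphi_{I,K})$$ are well-defined initial forms of $\mathcal R$, where the product is taken over all $\frac{m!}{p!\,q!}$ choices of the subsets $I,K$, and the monomial $\mu_{p,q}$ is given by $$\mu_{p,q}=a_0^{1+\sum_{|K'|=1,\dots,q-1}\prod_{k'\in K'}(\alpha_{k'}-1)}\;a_1^{\sum_{|K'|=q+1,\dots,m}\prod_{k'\in K'}(\alpha_{k'}-1)}\;\prod_{i=1}^m b_{i,0}^{\sum_{|K'|=q+1,\dots,m-1;\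 i\notin K'}\prod_{k'\in K'}(\alpha_{k'}-1)}\;b_{i,2}^{\delta(q)+\sum_{|K'|=1,\dots,q-2;\ i\notin K'}\prod_{k'\in K'}(\alpha_{k'}-1)},$$ where the sums run over subsets $K'\subset\{1,\dots,m\}$ of the indicated cardinalities, and $\delta(q)=0$ if $q\le m-1$, $\delta(q)=1$ otherwise.
   Context: Refined quiver resultant. Consider $$F_0=a_0+a_1z_1\cdots z_m,\qquad F_i=b_{i,0}+b_{i,1}z_i+b_{i,2}z_i^{\alpha_i}\quad(i=1,\dots,m),$$ with indeterminate coefficients. The refined quiver resultant $\mathcal R$ is the sparse mixed resultant of $F_0,\dots,F_m$: the irreducible polynomial with integer coefficients in the variables $a_0,a_1,b_{i,j}$, unique up to sign, which vanishes on the closure of the set of coefficient vectors (all coefficients nonzero) for which $F_0,\dots,F_m$ have a common root in $(\mathbb C\setminus\{0\})^m$. Initial form. For a polynomial $P$ and an integer vector $\omega$ (one entry per variable), the initial form of $P$ with respect to $\omega$ is the polynomial formed from all monomials (with their coefficients) of $P$ of maximal weight with respect to $\omega$; if $\omega$ is normal to a face of the Newton polytope of $P$, it is the restriction of $P$ to that face. The operator GCD. For a binomial $\eta^{\mathbf p}+\theta^{\mathbf q}$ with exponent vectors $\mathbf p,\mathbf q$ let $g=\gcd(\mathbf p,\mathbf q)$ be the greatest common divisor of all the exponents; then $\mathrm{GCD}(\eta^{\mathbf p}+\theta^{\mathbf q}):=(\eta^{\mathbf p/g}+\theta^{\mathbf q/g})^{g}$. If the second monomial carries a sign $\pm1$,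 this sign is kept: $\mathrm{GCD}(\eta^{\mathbf p}\pm\theta^{\mathbf q})=(\eta^{\mathbf p/g}\pm\theta^{\mathbf q/g})^{g}$.
   Formalization: As printed this is false. Proved: q≥1, δ(q)=1 for all q≥2 (0 for q=1), and the exponent of −1 in φ_{I,K} is 1+(p+1)∏_{k∈K}(α_k−1)/g+Σ_{k∈K}∏_{k'≠k}(α_{k'}−1)/g, with g the gcd of the exponents in φ_{I,K}; equality is up to a global sign. *)

theory Defs
  imports
    "HOL-Analysis.Analysis"
    "HOL-Library.Poly_Mapping"
    "HOL-Computational_Algebra.Factorial_Ring"
begin

section \<open>Integer polynomials in several variables\<close>

type_synonym 'v mpoly = "('v \<Rightarrow>\<^sub>0 nat) \<Rightarrow>\<^sub>0 int"

definition Var :: "'v \<Rightarrow> 'v mpoly" where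
  "Var v = Poly_Mapping.single (Poly_Mapping.single v 1) 1"

definition poly_eval :: "'v mpoly \<Rightarrow> ('v \<Rightarrow> complex) \<Rightarrow> complex" where
  "poly_eval P c =
     (\<Sum>u\<in>Poly_Mapping.keys P. of_int (Poly_Mapping.lookup P u) *
        (\<Prod>v\<in>Poly_Mapping.keys u. c v ^ Poly_Mapping.lookup u v))"

definition weight :: "('v \<Rightarrow> int) \<Rightarrow> ('v \<Rightarrow>\<^sub>0 nat) \<Rightarrow> int" where
  "weight \<omega> u = (\<Sum>v\<in>Poly_Mapping.keys u. \<omega> v * int (Poly_Mapping.lookup u v))"

definition initial_form :: "('v \<Rightarrow> int) \<Rightarrow> 'v mpoly \<Rightarrow> 'v mpoly" where
  "initial_form \<omega> P =
     (\<Sum>u | u \<in> Poly_Mapping.keys P \<and> (\<forall>w\<in>Poly_Mapping.keys P. weight \<omega> w \<le> weight \<omega> u).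
        Poly_Mapping.single u (Poly_Mapping.lookup P u))"


section \<open>The refined quiver resultant\<close>

text \<open>
  The index set \<open>{1, \<dots>, m}\<close> is a finite type \<open>'i\<close> with \<open>m = CARD('i)\<close>. The coefficients
  \<open>b\<^sub>i\<^sub>,\<^sub>0, b\<^sub>i\<^sub>,\<^sub>1, b\<^sub>i\<^sub>,\<^sub>2\<close> are \<open>B0 i, B1 i, B2 i\<close>.
\<close>

datatype 'i coeff = A0 | A1 | B0 'i | B1 'i | B2 'i

definition solvable_coeffs :: "('i::finite \<Rightarrow> nat) \<Rightarrow> ('i coeff \<Rightarrow> complex) set" where
  "solvable_coeffs \<alpha> =
     {c. (\<forall>v. c v \<noteq> 0) \<and>
         (\<exists>z :: 'i \<Rightarrow> complex.
            (\<forall>i. z i \<noteq> 0) \<and>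
            c A0 + c A1 * (\<Prod>i\<in>UNIV. z i) = 0 \<and>
            (\<forall>i. c (B0 i) + c (B1 i) * z i + c (B2 i) * z i ^ \<alpha> i = 0))}"

text \<open>
  The closure of \<open>solvable_coeffs \<alpha>\<close> is an irreducible hypersurface defined over the rationals,
  so the predicate below determines \<open>R\<close> up to sign. The Euclidean (product) topology is used;
  a polynomial vanishes on the Euclidean closure iff it vanishes on the Zariski closure.
\<close>

definition is_refined_quiver_resultant ::
    "('i::finite \<Rightarrow> nat) \<Rightarrow> 'i coeff mpoly \<Rightarrow> bool" where
  "is_refined_quiver_resultant \<alpha> R \<longleftrightarrow>
     irreducible R \<and> (\<forall>c\<in>closure (solvable_coeffs \<alpha>). poly_eval R c = 0)"


section \<open>Signed binomials and the operator GCD\<close>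

text \<open>\<open>Binomial u s w\<close> stands for \<open>\<eta>\<^sup>u + s \<theta>\<^sup>w\<close>; the sign \<open>s\<close> is \<open>1\<close> or \<open>-1\<close>.\<close>

datatype 'v binomial = Binomial "'v \<Rightarrow>\<^sub>0 nat" int "'v \<Rightarrow>\<^sub>0 nat"

definition exponents_gcd :: "('v \<Rightarrow>\<^sub>0 nat) \<Rightarrow> ('v \<Rightarrow>\<^sub>0 nat) \<Rightarrow> nat" where
  "exponents_gcd u w = Gcd (range (Poly_Mapping.lookup u) \<union> range (Poly_Mapping.lookup w))"

definition div_exponents :: "('v \<Rightarrow>\<^sub>0 nat) \<Rightarrow> nat \<Rightarrow> ('v \<Rightarrow>\<^sub>0 nat)" where
  "div_exponents u g = Poly_Mapping.map (\<lambda>n. n div g) u"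

fun GCD_op :: "'v binomial \<Rightarrow> 'v mpoly" where
  "GCD_op (Binomial u s w) =
     (let g = exponents_gcd u w
      in (Poly_Mapping.single (div_exponents u g) 1 +
          Poly_Mapping.single (div_exponents w g) s) ^ g)"


section \<open>The binomials phi and the monomials mu\<close>

definition prod_pred :: "('i \<Rightarrow> nat) \<Rightarrow> 'i set \<Rightarrow> nat" where
  "prod_pred \<alpha> K = (\<Prod>k\<in>K. \<alpha> k - 1)"

definition phi_first :: "('i \<Rightarrow> nat) \<Rightarrow> 'i set \<Rightarrow> 'i set \<Rightarrow> ('i coeff \<Rightarrow>\<^sub>0 nat)" where
  "phi_first \<alpha> I K =
     Poly_Mapping.single A0 (prod_pred \<alpha> K) +
     (\<Sum>i\<in>I. Poly_Mapping.single (B1 i) (prod_pred \<alpha> K)) +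
     (\<Sum>k\<in>K. Poly_Mapping.single (B2 k) (prod_pred \<alpha> (K - {k})))"

definition phi_second :: "('i \<Rightarrow> nat) \<Rightarrow> 'i set \<Rightarrow> 'i set \<Rightarrow> ('i coeff \<Rightarrow>\<^sub>0 nat)" where
  "phi_second \<alpha> I K =
     Poly_Mapping.single A1 (prod_pred \<alpha> K) +
     (\<Sum>i\<in>I. Poly_Mapping.single (B0 i) (prod_pred \<alpha> K)) +
     (\<Sum>k\<in>K. Poly_Mapping.single (B1 k) (prod_pred \<alpha> (K - {k})))"

text \<open>
  The sign of the second monomial. The source prints the exponent of \<open>-1\<close> as
  \<open>1 + (\<Sum>k\<in>K. \<Prod>k'\<in>K - {k}. \<alpha> k' - 1)\<close>. That is correct for some parameters only: for
  \<open>m = 2\<close>, \<open>\<alpha> = (2, 2)\<close>, \<open>K = {1, 2}\<close> it gives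
  \<open>a\<^sub>0 b\<^sub>1\<^sub>,\<^sub>2 b\<^sub>2\<^sub>,\<^sub>2 - a\<^sub>1 b\<^sub>1\<^sub>,\<^sub>1 b\<^sub>2\<^sub>,\<^sub>1\<close>, whereas the initial form has a plus sign. The corrected
  exponent used here comes from the factor
  \<open>\<Prod>z. a\<^sub>0 + a\<^sub>1 (\<Prod>i\<in>I. - b\<^sub>i\<^sub>,\<^sub>0 / b\<^sub>i\<^sub>,\<^sub>1) (\<Prod>k\<in>K. z k)\<close> of the resultant, with \<open>z k\<close> ranging over
  the roots of \<open>z k ^ (\<alpha> k - 1) = - b\<^sub>k\<^sub>,\<^sub>1 / b\<^sub>k\<^sub>,\<^sub>2\<close>. After multiplication by the denominators
  this factor is the \<open>g\<close>-th power of the binomial whose exponents are those of \<open>\<phi>\<close> divided by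
  \<open>g\<close>; the signs inside contribute \<open>1 + (card I + 1) n + (\<Sum>k\<in>K. e k)\<close>, where \<open>n\<close> and \<open>e k\<close>
  are the divided exponents of \<open>a\<^sub>1\<close> and \<open>b\<^sub>k\<^sub>,\<^sub>1\<close>.
\<close>

definition phi_sign :: "('i \<Rightarrow> nat) \<Rightarrow> 'i set \<Rightarrow> 'i set \<Rightarrow> int" where
  "phi_sign \<alpha> I K =
     (let g = exponents_gcd (phi_first \<alpha> I K) (phi_second \<alpha> I K)
      in (-1) ^ (1 + (card I + 1) * (prod_pred \<alpha> K div g)
                 + (\<Sum>k\<in>K. prod_pred \<alpha> (K - {k}) div g)))"

definition phi_binomial :: "('i \<Rightarrow> nat) \<Rightarrow> 'i set \<Rightarrow> 'i set \<Rightarrow> 'i coeff binomial" where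
  "phi_binomial \<alpha> I K =
     Binomial (phi_first \<alpha> I K) (phi_sign \<alpha> I K) (phi_second \<alpha> I K)"

text \<open>
  The source prints \<open>\<delta> q = 0\<close> for \<open>q \<le> m - 1\<close> and \<open>1\<close> otherwise. The resultant is homogeneous
  of degree \<open>\<Prod>j\<in>UNIV - {i}. \<alpha> j\<close> in \<open>b\<^sub>i\<^sub>,\<^sub>0, b\<^sub>i\<^sub>,\<^sub>1, b\<^sub>i\<^sub>,\<^sub>2\<close>, which forces \<open>\<delta> q = 1\<close> exactly
  for \<open>q \<ge> 2\<close>. Both conventions agree for \<open>m = 2\<close>; for \<open>m \<ge> 3\<close> and \<open>2 \<le> q \<le> m - 1\<close> the
  printed one makes the degree too small by one.
\<close>

definition delta :: "nat \<Rightarrow> nat" where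
  "delta q = (if q \<le> 1 then 0 else 1)"

text \<open>
  For \<open>q = 1\<close> truncated subtraction gives \<open>{1..q-2} = {1..0} = {}\<close>, as intended.
\<close>

definition mu :: "('i::finite \<Rightarrow> nat) \<Rightarrow> nat \<Rightarrow> 'i coeff mpoly" where
  "mu \<alpha> q =
     Var A0 ^ (1 + (\<Sum>K' | card K' \<in> {1..q-1}. prod_pred \<alpha> K')) *
     Var A1 ^ (\<Sum>K' | card K' \<in> {q+1..CARD('i)}. prod_pred \<alpha> K') *
     (\<Prod>i\<in>UNIV.
        Var (B0 i) ^ (\<Sum>K' | card K' \<in> {q+1..CARD('i)-1} \<and> i \<notin> K'. prod_pred \<alpha> K') *
        Var (B2 i) ^ (delta q + (\<Sum>K' | card K' \<in> {1..q-2} \<and> i \<notin> K'. prod_pred \<alpha> K')))"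

definition phi :: "('i::finite \<Rightarrow> nat) \<Rightarrow> nat \<Rightarrow> nat \<Rightarrow> 'i coeff mpoly" where
  "phi \<alpha> p q =
     mu \<alpha> q *
     (\<Prod>(I, K) | I \<union> K = UNIV \<and> I \<inter> K = {} \<and> card I = p \<and> card K = q.
        GCD_op (phi_binomial \<alpha> I K))"

end

theory Submission
  imports Defs "Jordan_Normal_Form.Char_Poly" "HOL-Computational_Algebra.Fundamental_Theorem_Algebra"
begin

text \<open>
  Let \<open>z i j\<close> be the roots of \<open>F i\<close>. Up to sign, the resultant is
  \<open>(\<Prod>i. b\<^sub>i\<^sub>,\<^sub>2 ^ (\<Prod>k \<noteq> i. \<alpha> k)) * (\<Prod>s. a\<^sub>0 + a\<^sub>1 (\<Prod>i. z i (s i)))\<close>: this is an integer polynomial, since it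
  is the determinant of the pencil \<open>a\<^sub>0 (\<Otimes>i. D i) + a\<^sub>1 (\<Otimes>i. C i)\<close>, where \<open>x D i - C i\<close> is a
  companion pencil of \<open>F i\<close>. It divides every integer polynomial \<open>R\<close> vanishing on the solvable
  coefficients: for generic coefficients the products \<open>\<Prod>i. z i (s i)\<close> are distinct, so the pseudo-remainder
  of \<open>R\<close> in \<open>a\<^sub>0\<close> is zero, and the leading coefficient, a monomial in the \<open>b\<^sub>i\<^sub>,\<^sub>2\<close>, can be cancelled.

  Give \<open>a\<^sub>0, a\<^sub>1, b\<^sub>i\<^sub>,\<^sub>0, b\<^sub>i\<^sub>,\<^sub>1, b\<^sub>i\<^sub>,\<^sub>2\<close> the weights \<open>q, 0, \<alpha> i - 1, \<alpha> i - 1, 0\<close>. Under the corresponding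
  scaling by \<open>k \<longlonglongrightarrow> \<infinity>\<close> one root of \<open>F i\<close> tends to \<open>- b\<^sub>i\<^sub>,\<^sub>0 / b\<^sub>i\<^sub>,\<^sub>1\<close>, and the others are asymptotic to \<open>k\<close> times
  the roots of \<open>y ^ (\<alpha> i - 1) = - b\<^sub>i\<^sub>,\<^sub>1 / b\<^sub>i\<^sub>,\<^sub>2\<close>. A factor of the resultant with large roots exactly at \<open>K\<close>
  is dominated by \<open>a\<^sub>0\<close> if \<open>card K < q\<close>, by the other term if \<open>card K > q\<close>, and keeps both terms if
  \<open>card K = q\<close>; the latter factors multiply up to \<open>GCD(\<phi>)\<close>, the others to \<open>\<mu>\<close>.
\<close>

section \<open>Evaluation of integer polynomials in commutative rings\<close>

definition monom_eval :: "('v \<Rightarrow> 'a::comm_ring_1) \<Rightarrow> ('v \<Rightarrow>\<^sub>0 nat) \<Rightarrow> 'a" where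
  "monom_eval h u = (\<Prod>v\<in>Poly_Mapping.keys u. h v ^ Poly_Mapping.lookup u v)"

text \<open>The target ring is arbitrary, so one notion covers evaluation at complex points and at
  integers, passage to univariate polynomials and substitution of polynomials for variables.
  \<open>poly_eval\<close> is the complex case.\<close>

definition mev :: "('v \<Rightarrow> 'a::comm_ring_1) \<Rightarrow> 'v mpoly \<Rightarrow> 'a" where
  "mev h P = (\<Sum>u\<in>Poly_Mapping.keys P. of_int (Poly_Mapping.lookup P u) * monom_eval h u)"

lemma poly_eval_eq_mev: "poly_eval P c = mev c P"
  by (simp add: poly_eval_def mev_def monom_eval_def)

lemma monom_eval_superset:
  assumes "finite A" "Poly_Mapping.keys u \<subseteq> A"
  shows "monom_eval h u = (\<Prod>v\<in>A. h v ^ Poly_Mapping.lookup u v)"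
  unfolding monom_eval_def using assms
  by (intro prod.mono_neutral_left) (auto simp: in_keys_iff)

lemma monom_eval_add: "monom_eval h (u + w) = monom_eval h u * monom_eval h w"
proof -
  let ?A = "Poly_Mapping.keys u \<union> Poly_Mapping.keys w"
  have "Poly_Mapping.keys (u + w) \<subseteq> ?A"
    by (rule Poly_Mapping.keys_add)
  then show ?thesis
    by (simp add: monom_eval_superset[of ?A] lookup_add power_add prod.distrib)
qed

lemma monom_eval_0 [simp]: "monom_eval h 0 = 1"
  by (simp add: monom_eval_def)

lemma monom_eval_single [simp]: "monom_eval h (Poly_Mapping.single v n) = h v ^ n"
  by (simp add: monom_eval_def)

lemma mev_single [simp]: "mev h (Poly_Mapping.single u a) = of_int a * monom_eval h u"
  by (simp add: mev_def)

lemma mev_0 [simp]: "mev h 0 = 0"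
  by (simp add: mev_def)

lemma mev_add: "mev h (P + Q) = mev h P + mev h Q"
  unfolding mev_def
  by (rule setsum_keys_plus_distrib) (auto simp: distrib_right)

lemma mev_sum: "mev h (sum f A) = (\<Sum>x\<in>A. mev h (f x))"
  by (induction A rule: infinite_finite_induct) (auto simp: mev_add)

lemma sum_single_lookup: "(\<Sum>u\<in>Poly_Mapping.keys P. Poly_Mapping.single u (Poly_Mapping.lookup P u)) = P"
  by (rule poly_mapping_eqI)
     (auto simp: lookup_sum lookup_single when_def in_keys_iff)

lemma mev_mult: "mev h (P * Q) = mev h P * mev h Q"
proof -
  have "P * Q = (\<Sum>u\<in>Poly_Mapping.keys P. \<Sum>w\<in>Poly_Mapping.keys Q.
      Poly_Mapping.single (u + w) (Poly_Mapping.lookup P u * Poly_Mapping.lookup Q w))"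
    by (subst (1 2) sum_single_lookup[symmetric])
       (simp add: sum_product mult_single)
  then show ?thesis
    by (simp add: mev_sum monom_eval_add) (simp add: mev_def sum_product mult_ac)
qed

lemma mev_1: "mev h 1 = 1"
  unfolding single_one[symmetric] by (subst mev_single) simp

interpretation mev: comm_ring_hom "mev h" for h :: "'v \<Rightarrow> 'a::comm_ring_1"
  by unfold_locales (auto simp: mev_add mev_mult mev_1)

lemma (in comm_ring_hom) hom_monom_eval: "hom (monom_eval h u) = monom_eval (\<lambda>v. hom (h v)) u"
  by (simp add: monom_eval_def hom_distribs)

lemma (in comm_ring_hom) hom_mev: "hom (mev h P) = mev (\<lambda>v. hom (h v)) P"
  by (simp add: mev_def hom_distribs hom_monom_eval)

lemma mev_Var [simp]: "mev h (Var v) = h v"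
  by (simp add: Var_def)

lemma single_power: "Poly_Mapping.single u (1::int) ^ n = Poly_Mapping.single (\<Sum>i<n. u) 1"
  by (induction n) (auto simp: mult_single add.commute)

lemma Var_power: "Var v ^ n = Poly_Mapping.single (Poly_Mapping.single v n) 1"
proof -
  have "(\<Sum>i<n. Poly_Mapping.single v (1::nat)) = Poly_Mapping.single v n"
    by (induction n) (auto simp: single_add[symmetric])
  then show ?thesis by (simp add: Var_def single_power)
qed

lemma monom_eval_Var: "monom_eval Var u = Poly_Mapping.single u 1"
proof -
  have "(\<Prod>v\<in>A. Var v ^ Poly_Mapping.lookup u v) =
      Poly_Mapping.single (\<Sum>v\<in>A. Poly_Mapping.single v (Poly_Mapping.lookup u v)) 1"
    if "finite A" for A
    using that by (induction A rule: finite_induct) (auto simp: Var_power mult_single)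
  then show ?thesis
    by (simp add: monom_eval_def sum_single_lookup)
qed

lemma mev_Var_id: "mev Var P = P"
proof -
  have "of_int a * Poly_Mapping.single u 1 = Poly_Mapping.single u a" for a :: int and u :: "'a \<Rightarrow>\<^sub>0 nat"
    using mult_single[of 0 a u 1] by (simp del: single_of_int add: single_of_int[symmetric])
  then show ?thesis
    by (simp add: mev_def monom_eval_Var sum_single_lookup)
qed

section \<open>Splitting off one variable\<close>

definition vars :: "'v mpoly \<Rightarrow> 'v set" where
  "vars P = (\<Union>u\<in>Poly_Mapping.keys P. Poly_Mapping.keys u)"

lemma mev_cong: "(\<And>v. v \<in> vars P \<Longrightarrow> h v = h' v) \<Longrightarrow> mev h P = mev h' P"
  unfolding mev_def monom_eval_def by (intro sum.cong prod.cong refl arg_cong2[of _ _ _ _ "(*)"] arg_cong2[of _ _ _ _ "(^)"]) (auto simp: vars_def)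

definition var_coeff :: "'v \<Rightarrow> nat \<Rightarrow> 'v mpoly \<Rightarrow> 'v mpoly" where
  "var_coeff v j P = (\<Sum>u | u \<in> Poly_Mapping.keys P \<and> Poly_Mapping.lookup u v = j.
      Poly_Mapping.single (Poly_Mapping.update v 0 u) (Poly_Mapping.lookup P u))"

lemma update_0_add_single: "Poly_Mapping.update v 0 u + Poly_Mapping.single v (Poly_Mapping.lookup u v) = (u :: 'v \<Rightarrow>\<^sub>0 nat)"
  by (rule poly_mapping_eqI) (auto simp: lookup_add lookup_update lookup_single when_def)

lemma mev_var_coeff:
  "mev h P = (\<Sum>j\<in>(\<lambda>u. Poly_Mapping.lookup u v) ` Poly_Mapping.keys P. h v ^ j * mev h (var_coeff v j P))"
proof -
  have m: "monom_eval h u = h v ^ Poly_Mapping.lookup u v * monom_eval h (Poly_Mapping.update v 0 u)" for u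
    by (subst update_0_add_single[of v u, symmetric], subst monom_eval_add) (simp add: mult.commute)
  have "mev h P = (\<Sum>j\<in>(\<lambda>u. Poly_Mapping.lookup u v) ` Poly_Mapping.keys P.
      \<Sum>u | u \<in> Poly_Mapping.keys P \<and> Poly_Mapping.lookup u v = j.
        of_int (Poly_Mapping.lookup P u) * monom_eval h u)"
    unfolding mev_def by (subst sum.image_gen[where g = "\<lambda>u. Poly_Mapping.lookup u v"]) auto
  also have "\<dots> = (\<Sum>j\<in>(\<lambda>u. Poly_Mapping.lookup u v) ` Poly_Mapping.keys P. h v ^ j * mev h (var_coeff v j P))"
    unfolding var_coeff_def mev_sum mev_single sum_distrib_left
    by (intro sum.cong refl, subst m) (auto simp: mult_ac)
  finally show ?thesis .
qed

lemma vars_var_coeff: "vars (var_coeff v j P) \<subseteq> vars P - {v}"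
proof -
  have "Poly_Mapping.keys (var_coeff v j P) \<subseteq> Poly_Mapping.update v 0 ` Poly_Mapping.keys P"
    unfolding var_coeff_def by (rule order.trans[OF Poly_Mapping.keys_sum]) (auto split: if_splits)
  then show ?thesis
    by (fastforce simp: vars_def keys_update)
qed

text \<open>Monomials with the same exponent of \<open>v\<close> stay distinct after that exponent
  is erased, so nothing cancels in the coefficient.\<close>

lemma var_coeff_nonzero:
  assumes "u \<in> Poly_Mapping.keys P"
  shows "var_coeff v (Poly_Mapping.lookup u v) P \<noteq> 0"
proof -
  let ?j = "Poly_Mapping.lookup u v"
  have inj: "u' = u" if "Poly_Mapping.lookup u' v = ?j" "Poly_Mapping.update v 0 u' = Poly_Mapping.update v 0 u" for u'
    using that update_0_add_single[of v u] update_0_add_single[of v u'] by metis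
  have "Poly_Mapping.lookup (var_coeff v ?j P) (Poly_Mapping.update v 0 u) =
      (\<Sum>u' | u' \<in> Poly_Mapping.keys P \<and> Poly_Mapping.lookup u' v = ?j.
         if u' = u then Poly_Mapping.lookup P u else 0)"
    unfolding var_coeff_def lookup_sum
    by (intro sum.cong) (auto simp: lookup_single when_def dest: inj)
  also have "\<dots> = Poly_Mapping.lookup P u"
    using assms by (subst sum.delta) auto
  finally show ?thesis
    using assms by (auto simp: in_keys_iff)
qed

section \<open>Generic points\<close>

text \<open>The quantifier "for all but finitely many values" is iterated over the list; the finite
  exceptional set of a variable may depend on the values assigned before it. The notion is stable
  under conjunction and yields a point.\<close>

primrec generic :: "'v list \<Rightarrow> (('v \<Rightarrow> complex) \<Rightarrow> bool) \<Rightarrow> ('v \<Rightarrow> complex) \<Rightarrow> bool" where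
  "generic [] Q c = Q c"
| "generic (v # vs) Q c = eventually (\<lambda>x. generic vs Q (c(v := x))) cofinite"

lemma generic_mono: "generic vs Q c \<Longrightarrow> (\<And>c. Q c \<Longrightarrow> Q' c) \<Longrightarrow> generic vs Q' c"
  by (induction vs arbitrary: c) (auto elim: eventually_mono)

lemma generic_conj: "generic vs Q c \<Longrightarrow> generic vs Q' c \<Longrightarrow> generic vs (\<lambda>c. Q c \<and> Q' c) c"
  by (induction vs arbitrary: c) (auto elim: eventually_elim2)

lemma generic_append: "generic (vs @ ws) Q c = generic vs (generic ws Q) c"
  by (induction vs arbitrary: c) auto

lemma generic_snoc:
  "generic (vs @ [v]) Q c = generic vs (\<lambda>c. eventually (\<lambda>x. Q (c(v := x))) cofinite) c"
  by (induction vs arbitrary: c) auto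

lemma generic_ex:
  assumes "generic vs Q c"
  obtains c' where "Q c'"
proof -
  have "generic vs Q c \<Longrightarrow> \<exists>c'. Q c'" for c
  proof (induction vs arbitrary: c)
    case (Cons v vs)
    then have "\<exists>x. generic vs Q (c(v := x))"
      by (simp add: eventually_cofinite) (metis (full_types) UNIV_I finite_subset infinite_UNIV_char_0 mem_Collect_eq subsetI)
    then show ?case using Cons.IH by blast
  qed auto
  with assms that show thesis by blast
qed

text \<open>Induction from the last, innermost variable: some coefficient of \<open>P\<close> in
  \<open>v\<close> is a nonzero polynomial, hence generically nonzero in the earlier variables, and
  there \<open>P\<close> becomes a nonzero univariate polynomial in \<open>v\<close> with finitely
  many roots.\<close>

lemma generic_mev_nonzero:
  assumes "P \<noteq> 0" "vars P \<subseteq> set vs"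
  shows "generic vs (\<lambda>c. mev c P \<noteq> 0) c"
  using assms
proof (induction vs arbitrary: P c rule: rev_induct)
  case Nil
  obtain a where "P = Poly_Mapping.single 0 a" "a \<noteq> 0"
  proof -
    have "Poly_Mapping.keys P \<subseteq> {0}"
      using Nil by (auto simp: vars_def)
    then have "P = Poly_Mapping.single 0 (Poly_Mapping.lookup P 0)"
      by (intro poly_mapping_eqI) (auto simp: lookup_single when_def in_keys_iff subset_iff)
    with that Nil(1) show thesis by (metis single_zero)
  qed
  then show ?case by simp
next
  case (snoc v vs P c)
  obtain u where u: "u \<in> Poly_Mapping.keys P"
    using snoc.prems(1) by fastforce
  define j where "j = Poly_Mapping.lookup u v"
  define J where "J = (\<lambda>u. Poly_Mapping.lookup u v) ` Poly_Mapping.keys P"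
  have J: "finite J" "j \<in> J" using u by (auto simp: J_def j_def)
  have "generic vs (\<lambda>c. mev c (var_coeff v j P) \<noteq> 0) c"
    using snoc.prems vars_var_coeff[of v j P]
    by (intro snoc.IH) (auto simp: j_def var_coeff_nonzero u)
  then have "generic vs (\<lambda>c. eventually (\<lambda>x. mev (c(v := x)) P \<noteq> 0) cofinite) c"
  proof (rule generic_mono)
    fix c :: "'a \<Rightarrow> complex"
    assume *: "mev c (var_coeff v j P) \<noteq> 0"
    define p where "p = (\<Sum>i\<in>J. monom (mev c (var_coeff v i P)) i)"
    have "coeff p j = mev c (var_coeff v j P)"
      using J by (simp add: p_def coeff_sum)
    then have "p \<noteq> 0" using * by auto
    have "mev (c(v := x)) (var_coeff v i P) = mev c (var_coeff v i P)" for x i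
      using vars_var_coeff[of v i P] by (intro mev_cong) auto
    then have "mev (c(v := x)) P = poly p x" for x
      by (subst mev_var_coeff[of _ _ v])
         (simp add: p_def J_def poly_sum poly_monom mult.commute)
    then show "eventually (\<lambda>x. mev (c(v := x)) P \<noteq> 0) cofinite"
      using poly_roots_finite[OF \<open>p \<noteq> 0\<close>] by (simp add: eventually_cofinite)
  qed
  then show ?case by (simp add: generic_snoc)
qed

section \<open>Identity principle, zero divisors and units\<close>

lemma mev_generic_eqI:
  assumes "generic vs G c" "set vs = UNIV" "\<And>c. G c \<Longrightarrow> mev c P = mev c Q"
  shows "P = Q"
proof (rule ccontr)
  assume "P \<noteq> Q"
  then have "generic vs (\<lambda>c. mev c (P - Q) \<noteq> 0) c"
    using assms(2) by (intro generic_mev_nonzero) auto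
  from generic_conj[OF assms(1) this] obtain c' where "G c'" "mev c' (P - Q) \<noteq> 0"
    by (rule generic_ex) blast
  with assms(3) show False by (simp add: mev.hom_minus)
qed

text \<open>The difference involves only finitely many variables, so genericity in these suffices
  even for an infinite type of variables.\<close>

lemma mev_complex_inj:
  assumes "\<And>c. mev c P = (mev c Q :: complex)"
  shows "P = Q"
proof (rule ccontr)
  assume "P \<noteq> Q"
  have "finite (vars (P - Q))" by (simp add: vars_def)
  then obtain vs where "set vs = vars (P - Q)"
    using finite_list by blast
  then have "generic vs (\<lambda>c. mev c (P - Q) \<noteq> 0) (\<lambda>_. 0)"
    using \<open>P \<noteq> Q\<close> by (intro generic_mev_nonzero) auto
  then show False
    by (rule generic_ex) (use assms in \<open>simp add: mev.hom_minus\<close>)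
qed

text \<open>Two nonzero factors are nonzero at a common generic point, where the product of their
  complex values would have to vanish.\<close>

lemma mpoly_mult_eq_0D:
  fixes P Q :: "'v mpoly"
  assumes "P * Q = 0" "P \<noteq> 0"
  shows "Q = 0"
proof (rule ccontr)
  assume "Q \<noteq> 0"
  have "finite (vars P \<union> vars Q)" by (simp add: vars_def)
  then obtain vs where vs: "set vs = vars P \<union> vars Q"
    using finite_list by blast
  have "generic vs (\<lambda>c. mev c P \<noteq> 0) (\<lambda>_. 0)" "generic vs (\<lambda>c. mev c Q \<noteq> 0) (\<lambda>_. 0)"
    using vs \<open>Q \<noteq> 0\<close> assms(2) by (auto intro!: generic_mev_nonzero)
  from generic_conj[OF this] obtain c' :: "'v \<Rightarrow> complex" where "mev c' P \<noteq> 0" "mev c' Q \<noteq> 0"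
    by (rule generic_ex) blast
  moreover have "mev c' P * mev c' Q = 0"
    using assms(1) by (metis mev_mult mev_0)
  ultimately show False by simp
qed

text \<open>Substituting \<open>c v\<close> times an indeterminate for each variable turns a unit
  into a unit of the univariate complex polynomials, hence into a constant. Comparing its values at
  1 and 0 shows that \<open>S\<close> equals its constant coefficient, which is an integer
  unit.\<close>

lemma mpoly_unit:
  fixes S :: "'v mpoly"
  assumes "S dvd 1"
  shows "S = 1 \<or> S = - 1"
proof -
  obtain T where T: "S * T = 1" using assms by (auto elim: dvdE)
  define s t where "s = mev (\<lambda>_. 0 :: int) S" and "t = mev (\<lambda>_. 0 :: int) T"
  have "s * t = 1" using T by (metis mev_mult mev_1 s_def t_def)
  then have s: "s = 1 \<or> s = - 1" by (simp add: zmult_eq_1_iff) blast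
  have "mev c S = mev c (of_int s)" for c :: "'v \<Rightarrow> complex"
  proof -
    define p q where "p = mev (\<lambda>v. [:0, c v:]) S" and "q = mev (\<lambda>v. [:0, c v:]) T"
    have "p * q = 1" using T by (metis mev_mult mev_1 p_def q_def)
    then have "p dvd 1" by (metis dvd_triv_left)
    then obtain a where p: "p = [:a:]"
      by (metis is_unit_poly_iff)
    have "mev c S = poly p 1" "mev (\<lambda>_. 0) S = poly p 0"
      unfolding p_def by (simp_all add: poly_hom.hom_mev)
    then have "mev c S = mev (\<lambda>_. 0) S" by (simp add: p)
    also have "\<dots> = of_int s"
      unfolding s_def by (simp add: of_int_hom.hom_mev)
    finally show ?thesis by (simp add: mev.hom_of_int)
  qed
  then have "S = of_int s" by (rule mev_complex_inj)
  with s show ?thesis by auto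
qed

section \<open>Integer polynomials as univariate polynomials in one variable\<close>

text \<open>The coefficients stay in the full ring of integer polynomials, although \<open>v\<close>
  does not occur in them; evaluating at \<open>Var v\<close> therefore gives back the
  polynomial.\<close>

definition univariate :: "'v \<Rightarrow> 'v mpoly \<Rightarrow> 'v mpoly poly" where
  "univariate v = mev (\<lambda>w. if w = v then [:0, 1:] else [:Var w:])"

definition subst0 :: "'v \<Rightarrow> 'v mpoly \<Rightarrow> 'v mpoly" where
  "subst0 v = mev (\<lambda>w. if w = v then 0 else Var w)"

lemma subst0_mult: "subst0 v (P * Q) = subst0 v P * subst0 v Q"
  by (simp add: subst0_def mev_mult)

lemma poly_univariate_Var: "poly (univariate v P) (Var v) = P"
proof -
  have "poly (univariate v P) (Var v) = mev Var P"
    unfolding univariate_def poly_hom.hom_mev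
    by (rule arg_cong2[of _ _ _ _ mev]) auto
  then show ?thesis by (simp add: mev_Var_id)
qed

lemma poly_univariate_0: "poly (univariate v P) 0 = subst0 v P"
  unfolding univariate_def subst0_def poly_hom.hom_mev
  by (rule arg_cong2[of _ _ _ _ mev]) auto

lemma mev_subst0: "mev c (subst0 v P) = mev (c(v := 0)) P"
  unfolding subst0_def mev.hom_mev
  by (rule arg_cong2[of _ _ _ _ mev]) (auto simp: mev.hom_zero)

lemma poly_map_univariate: "poly (map_poly (mev c) (univariate v P)) x = mev (c(v := x)) P"
proof -
  interpret map_poly_comm_ring_hom "mev c" ..
  have const: "map_poly (mev c) [:a:] = [:mev c a:]" for a
    by (rule poly_eqI) (auto simp: coeff_map_poly coeff_pCons mev.hom_zero split: nat.split)
  show ?thesis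
    unfolding univariate_def hom_mev poly_hom.hom_mev
    by (rule arg_cong2[of _ _ _ _ mev]) (auto simp: fun_eq_iff const map_poly_pCons mev.hom_zero mev.hom_one)
qed

lemma Var_dvd_of_subst0:
  assumes "subst0 v P = 0"
  shows "Var v dvd P"
proof -
  obtain a p where p: "univariate v P = pCons a p" by (rule pCons_cases)
  have "a = 0" using poly_univariate_0[of v P] assms by (simp add: p)
  then have "P = Var v * poly p (Var v)"
    using poly_univariate_Var[of v P] by (simp add: p)
  then show ?thesis by (metis dvd_triv_left)
qed

text \<open>This expresses that \<open>Var v\<close> is prime: if setting \<open>v\<close> to 0 does
  not kill \<open>P\<close>, then it kills the cofactor \<open>Y\<close>, so \<open>Var v\<close>
  can be taken out of \<open>Y\<close> and cancelled.\<close>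

lemma subst0_dvd_cancel:
  fixes P :: "'v mpoly"
  assumes "subst0 v P \<noteq> 0" "P dvd Var v * X"
  shows "P dvd X"
proof -
  obtain Y where Y: "Var v * X = P * Y" using assms(2) by (auto elim: dvdE)
  have "subst0 v (Var v) = 0" by (simp add: subst0_def)
  then have "subst0 v P * subst0 v Y = 0"
    using Y by (simp add: subst0_mult[symmetric]) (simp add: Y[symmetric] subst0_mult)
  then have "subst0 v Y = 0"
    using assms(1) by (rule mpoly_mult_eq_0D)
  from Var_dvd_of_subst0[OF this] obtain Z where "Y = Var v * Z"
    by (rule dvdE)
  then have "Var v * (X - P * Z) = 0"
    using Y by (simp add: algebra_simps)
  moreover have "Var v \<noteq> 0"
    by (simp add: Var_def)
  ultimately have "X - P * Z = 0"
    by (rule mpoly_mult_eq_0D)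
  then show ?thesis by simp
qed

section \<open>Determinants indexed by finite sets\<close>

definition enum_set :: "'b set \<Rightarrow> nat \<Rightarrow> 'b" where
  "enum_set S = (SOME e. bij_betw e {0..<card S} S)"

text \<open>Rows and columns use the same enumeration, so the value does not depend on the choice
  made by \<open>enum_set\<close>. This allows matrices indexed by tuples, as in a tensor
  product.\<close>

definition fin_det :: "'b set \<Rightarrow> ('b \<Rightarrow> 'b \<Rightarrow> 'a::comm_ring_1) \<Rightarrow> 'a" where
  "fin_det S f = Determinant.det (Matrix.mat (card S) (card S) (\<lambda>(i, j). f (enum_set S i) (enum_set S j)))"

lemma bij_betw_enum_set: "finite S \<Longrightarrow> bij_betw (enum_set S) {0..<card S} S"
  unfolding enum_set_def by (rule someI_ex[of "\<lambda>e. bij_betw e {0..<card S} S"]) (rule ex_bij_betw_nat_finite)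

lemma enum_set_in: "finite S \<Longrightarrow> i < card S \<Longrightarrow> enum_set S i \<in> S"
  using bij_betw_enum_set[of S] by (auto dest: bij_betwE)

lemma enum_set_eq_iff:
  "finite S \<Longrightarrow> i < card S \<Longrightarrow> j < card S \<Longrightarrow> enum_set S i = enum_set S j \<longleftrightarrow> i = j"
  using bij_betw_enum_set[of S] by (auto simp: bij_betw_def inj_on_eq_iff)

lemma fin_det_cong:
  assumes "finite S" "\<And>s t. s \<in> S \<Longrightarrow> t \<in> S \<Longrightarrow> f s t = g s t"
  shows "fin_det S f = fin_det S g"
  unfolding fin_det_def
  by (rule arg_cong[where f = Determinant.det], rule eq_matI) (auto simp: assms enum_set_in)

lemma fin_det_mult:
  assumes "finite S"
  shows "fin_det S (\<lambda>s t. \<Sum>r\<in>S. f s r * g r t) = fin_det S f * fin_det S g"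
proof -
  have "(\<Sum>r\<in>S. f s r * g r t) = (\<Sum>k = 0..<card S. f s (enum_set S k) * g (enum_set S k) t)" for s t
    by (rule sum.reindex_bij_betw[symmetric]) (rule bij_betw_enum_set[OF assms])
  then have "Matrix.mat (card S) (card S) (\<lambda>(i, j). \<Sum>r\<in>S. f (enum_set S i) r * g r (enum_set S j)) =
      Matrix.mat (card S) (card S) (\<lambda>(i, j). f (enum_set S i) (enum_set S j)) *
      Matrix.mat (card S) (card S) (\<lambda>(i, j). g (enum_set S i) (enum_set S j))"
    by (intro eq_matI) (auto simp: scalar_prod_def)
  then show ?thesis
    unfolding fin_det_def by (simp add: det_mult[of _ "card S"])
qed

lemma fin_det_diag:
  assumes "finite S"
  shows "fin_det S (\<lambda>s t. if s = t then d s else 0) = (\<Prod>s\<in>S. d s)"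
proof -
  have "fin_det S (\<lambda>s t. if s = t then d s else 0) = (\<Prod>i = 0..<card S. d (enum_set S i))"
    unfolding fin_det_def
    by (subst det_lower_triangular[of "card S"])
       (auto simp: enum_set_eq_iff[OF assms] prod_list_diag_prod)
  also have "\<dots> = (\<Prod>s\<in>S. d s)"
    by (rule prod.reindex_bij_betw) (rule bij_betw_enum_set[OF assms])
  finally show ?thesis .
qed

lemma fin_det_scale:
  assumes "finite S"
  shows "fin_det S (\<lambda>s t. a s * f s t * b t) = (\<Prod>s\<in>S. a s) * fin_det S f * (\<Prod>s\<in>S. b s)"
proof -
  have "fin_det S (\<lambda>s t. a s * f s t * b t) =
      fin_det S (\<lambda>s t. \<Sum>r\<in>S. (if s = r then a s else 0) *
        (\<Sum>q\<in>S. f r q * (if q = t then b q else 0)))"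
    using assms by (intro fin_det_cong) (auto simp: if_distrib[of "\<lambda>x. x * y" for y] if_distrib[of "\<lambda>x. y * x" for y] mult_ac cong: if_cong)
  then show ?thesis
    by (simp add: fin_det_mult[OF assms] fin_det_diag[OF assms])
qed

lemma (in comm_ring_hom) hom_fin_det: "hom (fin_det S f) = fin_det S (\<lambda>s t. hom (f s t))"
  unfolding fin_det_def hom_det[symmetric]
  by (rule arg_cong[where f = Determinant.det], rule eq_matI) auto

lemma fin_det_1: "finite S \<Longrightarrow> fin_det S (\<lambda>s t. if s = t then 1 else 0) = 1"
  using fin_det_diag[of S "\<lambda>_. 1"] by simp

section \<open>The resultant as the determinant of a pencil\<close>

definition idx :: "('i::finite \<Rightarrow> nat) \<Rightarrow> ('i \<Rightarrow> nat) set" where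
  "idx \<alpha> = PiE UNIV (\<lambda>i. {..<\<alpha> i})"

text \<open>\<open>diag_entry\<close> and \<open>companion_entry\<close> form the companion pencil
  of \<open>b0 + b1 * z + b2 * z ^ n\<close> without division by \<open>b2\<close>: for a root
  \<open>z\<close>, the row of its powers times the companion matrix is \<open>z\<close> times that
  row times the diagonal matrix.\<close>

definition diag_entry :: "nat \<Rightarrow> 'a::comm_ring_1 \<Rightarrow> nat \<Rightarrow> 'a" where
  "diag_entry n b2 k = (if Suc k = n then b2 else 1)"

definition companion_entry :: "nat \<Rightarrow> 'a::comm_ring_1 \<Rightarrow> 'a \<Rightarrow> nat \<Rightarrow> nat \<Rightarrow> 'a" where
  "companion_entry n b0 b1 j k =
     (if Suc k < n then if j = Suc k then 1 else 0
      else if j = 0 then - b0 else if j = 1 then - b1 else 0)"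

text \<open>The determinant is taken over any commutative ring: at \<open>Var\<close> it is an
  integer polynomial, and homomorphisms carry it to the determinant at the images. The two products
  are entries of tensor products over all indices.\<close>

definition pencil_det :: "('i::finite \<Rightarrow> nat) \<Rightarrow> ('i coeff \<Rightarrow> 'a::comm_ring_1) \<Rightarrow> 'a" where
  "pencil_det \<alpha> h = fin_det (idx \<alpha>) (\<lambda>s t.
     h A0 * (\<Prod>i\<in>UNIV. if s i = t i then diag_entry (\<alpha> i) (h (B2 i)) (t i) else 0) +
     h A1 * (\<Prod>i\<in>UNIV. companion_entry (\<alpha> i) (h (B0 i)) (h (B1 i)) (s i) (t i)))"

definition quiver_res :: "('i::finite \<Rightarrow> nat) \<Rightarrow> 'i coeff mpoly" where
  "quiver_res \<alpha> = pencil_det \<alpha> Var"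

lemma (in comm_ring_hom) hom_diag_entry: "hom (diag_entry n b k) = diag_entry n (hom b) k"
  by (simp add: diag_entry_def)

lemma (in comm_ring_hom) hom_companion_entry:
  "hom (companion_entry n b c j k) = companion_entry n (hom b) (hom c) j k"
  by (simp add: companion_entry_def hom_distribs)

lemma (in comm_ring_hom) hom_pencil_det: "hom (pencil_det \<alpha> h) = pencil_det \<alpha> (\<lambda>v. hom (h v))"
  unfolding pencil_det_def
  by (simp add: hom_fin_det hom_distribs hom_diag_entry hom_companion_entry if_distrib[of hom] hom_zero cong: if_cong)

lemma mev_quiver_res: "mev h (quiver_res \<alpha>) = pencil_det \<alpha> h"
  by (simp add: quiver_res_def mev.hom_pencil_det)

lemma finite_idx [simp]: "finite (idx \<alpha>)"
  by (auto simp: idx_def intro: finite_PiE)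

lemma idx_iff: "s \<in> idx \<alpha> \<longleftrightarrow> (\<forall>i. s i < \<alpha> i)"
  by (auto simp: idx_def PiE_def Pi_def)

section \<open>Diagonalization of the pencil by powers of the roots\<close>

lemma vandermonde_inverse:
  fixes z :: "nat \<Rightarrow> 'a::field"
  assumes "inj_on z {..<n}"
  obtains W where "\<And>s t. s < n \<Longrightarrow> t < n \<Longrightarrow> (\<Sum>j<n. z s ^ j * W j t) = (if s = t then 1 else 0)"
proof -
  \<comment> \<open>\<open>L t\<close> is the Lagrange polynomial that is 1 at \<open>z t\<close>
    and 0 at the other nodes; its coefficients form column \<open>t\<close> of the inverse
    Vandermonde matrix.\<close>
  define L where "L t = (\<Prod>u\<in>{..<n} - {t}. Polynomial.smult (1 / (z t - z u)) [:- z u, 1:])" for t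
  have deg: "degree (L t) < n" if "t < n" for t
  proof -
    have 1: "degree (Polynomial.smult a [:b, 1:]) \<le> 1" for a b :: 'a
      by (rule order.trans[OF degree_smult_le]) simp
    have "degree (L t) \<le> (\<Sum>u\<in>{..<n} - {t}. degree (Polynomial.smult (1 / (z t - z u)) [:- z u, 1:]))"
      unfolding L_def by (rule order.trans[OF degree_prod_sum_le]) (auto simp: comp_def)
    also have "\<dots> \<le> (\<Sum>u\<in>{..<n} - {t}. 1)"
      by (rule sum_mono) (rule 1)
    finally have "degree (L t) \<le> card ({..<n} - {t})" by simp
    with that show ?thesis by simp
  qed
  have val: "poly (L t) (z s) = (if s = t then 1 else 0)" if "s < n" "t < n" for s t
  proof -
    have "poly (L t) (z s) = (\<Prod>u\<in>{..<n} - {t}. (z s - z u) / (z t - z u))"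
      by (simp add: L_def poly_prod diff_divide_distrib)
    also have "\<dots> = (if s = t then 1 else 0)"
      using that assms by (auto simp: inj_on_eq_iff prod_zero_iff intro!: prod.neutral)
    finally show ?thesis .
  qed
  show thesis
  proof (rule that[of "\<lambda>j t. Polynomial.coeff (L t) j"])
    fix s t assume st: "s < n" "t < n"
    have "(\<Sum>j<n. z s ^ j * Polynomial.coeff (L t) j) = (\<Sum>j\<le>degree (L t). Polynomial.coeff (L t) j * z s ^ j)"
      using deg[OF st(2)]
      by (intro sum.mono_neutral_cong_right) (auto simp: coeff_eq_0 not_le)
    also have "\<dots> = (if s = t then 1 else 0)"
      using val[OF st] by (simp add: poly_altdef)
    finally show "(\<Sum>j<n. z s ^ j * Polynomial.coeff (L t) j) = (if s = t then 1 else 0)" .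
  qed
qed

text \<open>Every column but the last only shifts powers; in the last one the root equation turns
  \<open>- (b0 + b1 * z)\<close> into \<open>b2 * z ^ n\<close>.\<close>

lemma vandermonde_companion:
  fixes z :: "'a::comm_ring_1"
  assumes "k < n" "2 \<le> n" "b0 + b1 * z + b2 * z ^ n = 0"
  shows "(\<Sum>j<n. z ^ j * companion_entry n b0 b1 j k) = z * (z ^ k * diag_entry n b2 k)"
proof (cases "Suc k < n")
  case True
  then have "(\<Sum>j<n. z ^ j * companion_entry n b0 b1 j k) = (\<Sum>j<n. if j = Suc k then z ^ Suc k else 0)"
    by (intro sum.cong) (auto simp: companion_entry_def)
  with True show ?thesis by (simp add: diag_entry_def)
next
  case False
  with assms have k: "n = Suc k" by simp
  have "(\<Sum>j<n. z ^ j * companion_entry n b0 b1 j k) = (\<Sum>j\<in>{0, 1}. z ^ j * companion_entry n b0 b1 j k)"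
    using assms k by (intro sum.mono_neutral_right) (auto simp: companion_entry_def)
  also have "\<dots> = - (b0 + b1 * z)"
    using k by (simp add: companion_entry_def)
  also have "\<dots> = b2 * z ^ n"
    using assms(3) by (metis add_eq_0_iff)
  also have "\<dots> = z * (z ^ k * diag_entry n b2 k)"
    using k by (simp add: diag_entry_def)
  finally show ?thesis .
qed

text \<open>For fixed \<open>i\<close> the entry equals \<open>b i\<close> exactly when
  \<open>t i\<close> takes its top value, which leaves the other coordinates free.\<close>

lemma prod_diag_entry:
  "(\<Prod>t\<in>idx \<alpha>. \<Prod>i\<in>UNIV. diag_entry (\<alpha> i) (b i) (t i)) = (\<Prod>i\<in>UNIV. b i ^ (\<Prod>k\<in>UNIV - {i}. \<alpha> k))"
  if pos: "\<And>i. 0 < \<alpha> i"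
proof -
  have "(\<Prod>t\<in>idx \<alpha>. diag_entry (\<alpha> i) (b i) (t i)) = b i ^ (\<Prod>k\<in>UNIV - {i}. \<alpha> k)" for i
  proof -
    have *: "{t \<in> idx \<alpha>. Suc (t i) = \<alpha> i} = PiE UNIV (\<lambda>k. if k = i then {\<alpha> i - 1} else {..<\<alpha> k})"
      (is "?A = ?B")
    proof (rule Set.set_eqI, rule iffI)
      fix t assume "t \<in> ?A" then show "t \<in> ?B" by (auto simp: idx_iff PiE_iff)
    next
      fix t assume t: "t \<in> ?B"
      have "t k < \<alpha> k" for k using t pos[of i] by (cases "k = i") (auto simp: PiE_iff dest: spec[of _ k])
      moreover have "Suc (t i) = \<alpha> i" using t pos[of i] by (auto simp: PiE_iff dest: spec[of _ i])
      ultimately show "t \<in> ?A" by (auto simp: idx_iff)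
    qed
    have "card {t \<in> idx \<alpha>. Suc (t i) = \<alpha> i} = (\<Prod>k\<in>UNIV. if k = i then 1 else \<alpha> k)"
      unfolding * by (subst card_PiE) (auto intro!: prod.cong)
    also have "\<dots> = (\<Prod>k\<in>UNIV - {i}. \<alpha> k)"
      by (subst prod.remove[of _ i]) auto
    finally show ?thesis
      by (simp add: diag_entry_def prod.If_cases Int_def)
  qed
  then show ?thesis by (subst prod.swap) simp
qed

text \<open>
  The tensor product of the Vandermonde matrices of the roots diagonalizes the pencil.
\<close>

lemma pencil_det_eq_prod_roots:
  fixes h :: "'i::finite coeff \<Rightarrow> 'a::field"
  assumes \<alpha>: "\<And>i. 2 \<le> \<alpha> i"
    and inj: "\<And>i. inj_on (z i) {..<\<alpha> i}"
    and root: "\<And>i j. j < \<alpha> i \<Longrightarrow> h (B0 i) + h (B1 i) * z i j + h (B2 i) * z i j ^ \<alpha> i = 0"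
  shows "pencil_det \<alpha> h = (\<Prod>i\<in>UNIV. h (B2 i) ^ (\<Prod>k\<in>UNIV - {i}. \<alpha> k)) *
     (\<Prod>s\<in>idx \<alpha>. h A0 + h A1 * (\<Prod>i\<in>UNIV. z i (s i)))"
proof -
  define V where "V s t = (\<Prod>i\<in>UNIV. z i (s i) ^ t i)" for s t :: "'i \<Rightarrow> nat"
  define M where "M s t = h A0 * (\<Prod>i\<in>UNIV. if s i = t i then diag_entry (\<alpha> i) (h (B2 i)) (t i) else 0) +
     h A1 * (\<Prod>i\<in>UNIV. companion_entry (\<alpha> i) (h (B0 i)) (h (B1 i)) (s i) (t i))" for s t
  define d where "d t = (\<Prod>i\<in>UNIV. diag_entry (\<alpha> i) (h (B2 i)) (t i))" for t
  define l where "l s = h A0 + h A1 * (\<Prod>i\<in>UNIV. z i (s i))" for s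
  \<comment> \<open>A sum over all tuples of a product over coordinates factors into one-dimensional
    sums, so everything reduces to one index \<open>i\<close> at a time.\<close>
  have sumV: "(\<Sum>r\<in>idx \<alpha>. V s r * (\<Prod>i\<in>UNIV. f i (r i))) = (\<Prod>i\<in>UNIV. \<Sum>j<\<alpha> i. z i (s i) ^ j * f i j)" for s f
    unfolding idx_def V_def by (subst prod_sum_PiE) (auto simp: prod.distrib)
  have "\<exists>W. \<forall>s<\<alpha> i. \<forall>t<\<alpha> i. (\<Sum>j<\<alpha> i. z i s ^ j * W j t) = (if s = t then 1 else 0)" for i
    using vandermonde_inverse[OF inj[of i]] by metis
  then obtain W where W: "\<And>i s t. s < \<alpha> i \<Longrightarrow> t < \<alpha> i \<Longrightarrow>
      (\<Sum>j<\<alpha> i. z i s ^ j * W i j t) = (if s = t then 1 else 0)"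
    by metis
  have "fin_det (idx \<alpha>) V * fin_det (idx \<alpha>) (\<lambda>s t. \<Prod>i\<in>UNIV. W i (s i) (t i)) =
     fin_det (idx \<alpha>) (\<lambda>s t. if s = t then 1 else 0)"
    unfolding fin_det_mult[OF finite_idx, symmetric]
  proof (rule fin_det_cong)
    fix s t assume st: "s \<in> idx \<alpha>" "t \<in> idx \<alpha>"
    have "(\<Sum>r\<in>idx \<alpha>. V s r * (\<Prod>i\<in>UNIV. W i (r i) (t i))) = (\<Prod>i\<in>UNIV. if s i = t i then 1 else 0)"
      using st by (subst sumV) (auto simp: W idx_iff)
    also have "\<dots> = (if s = t then 1 else 0)"
      by (auto simp: fun_eq_iff)
    finally show "(\<Sum>r\<in>idx \<alpha>. V s r * (\<Prod>i\<in>UNIV. W i (r i) (t i))) = (if s = t then 1 else 0)" .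
  qed auto
  then have nz: "fin_det (idx \<alpha>) V \<noteq> 0"
    by (auto simp: fin_det_1)
  \<comment> \<open>\<open>V\<close> times the pencil is \<open>V\<close> with rows scaled by
    \<open>l\<close> and columns scaled by \<open>d\<close>; the nonzero determinant of
    \<open>V\<close> then cancels.\<close>
  have "fin_det (idx \<alpha>) V * fin_det (idx \<alpha>) M = fin_det (idx \<alpha>) (\<lambda>s t. l s * V s t * d t)"
    unfolding fin_det_mult[OF finite_idx, symmetric]
  proof (rule fin_det_cong)
    fix s t assume st: "s \<in> idx \<alpha>" "t \<in> idx \<alpha>"
    have D: "(\<Sum>j<\<alpha> i. z i (s i) ^ j * (if j = t i then diag_entry (\<alpha> i) (h (B2 i)) (t i) else 0)) =
        z i (s i) ^ t i * diag_entry (\<alpha> i) (h (B2 i)) (t i)" for i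
      using st by (simp add: if_distrib idx_iff cong: if_cong)
    have C: "(\<Sum>j<\<alpha> i. z i (s i) ^ j * companion_entry (\<alpha> i) (h (B0 i)) (h (B1 i)) j (t i)) =
        z i (s i) * (z i (s i) ^ t i * diag_entry (\<alpha> i) (h (B2 i)) (t i))" for i
      using st by (intro vandermonde_companion \<alpha> root) (auto simp: idx_iff)
    have "(\<Sum>r\<in>idx \<alpha>. V s r * M r t) =
        h A0 * (\<Sum>r\<in>idx \<alpha>. V s r * (\<Prod>i\<in>UNIV. if r i = t i then diag_entry (\<alpha> i) (h (B2 i)) (t i) else 0)) +
        h A1 * (\<Sum>r\<in>idx \<alpha>. V s r * (\<Prod>i\<in>UNIV. companion_entry (\<alpha> i) (h (B0 i)) (h (B1 i)) (r i) (t i)))"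
      by (simp add: M_def distrib_left sum.distrib sum_distrib_left mult_ac)
    also have "\<dots> = h A0 * (\<Prod>i\<in>UNIV. z i (s i) ^ t i * diag_entry (\<alpha> i) (h (B2 i)) (t i)) +
        h A1 * (\<Prod>i\<in>UNIV. z i (s i) * (z i (s i) ^ t i * diag_entry (\<alpha> i) (h (B2 i)) (t i)))"
      using sumV[of s "\<lambda>i j. if j = t i then diag_entry (\<alpha> i) (h (B2 i)) (t i) else 0"]
        sumV[of s "\<lambda>i j. companion_entry (\<alpha> i) (h (B0 i)) (h (B1 i)) j (t i)"]
      by (simp only: D C)
    also have "\<dots> = l s * V s t * d t"
      by (simp add: l_def V_def d_def prod.distrib algebra_simps)
    finally show "(\<Sum>r\<in>idx \<alpha>. V s r * M r t) = l s * V s t * d t" .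
  qed auto
  also have "\<dots> = (\<Prod>s\<in>idx \<alpha>. l s) * fin_det (idx \<alpha>) V * (\<Prod>t\<in>idx \<alpha>. d t)"
    by (rule fin_det_scale) simp
  finally have "fin_det (idx \<alpha>) M = (\<Prod>t\<in>idx \<alpha>. d t) * (\<Prod>s\<in>idx \<alpha>. l s)"
    using nz by simp
  moreover have "(\<Prod>t\<in>idx \<alpha>. d t) = (\<Prod>i\<in>UNIV. h (B2 i) ^ (\<Prod>k\<in>UNIV - {i}. \<alpha> k))"
    unfolding d_def using \<alpha> by (intro prod_diag_entry) (meson less_le_trans zero_less_numeral)
  moreover have "pencil_det \<alpha> h = fin_det (idx \<alpha>) M"
    unfolding pencil_det_def M_def ..
  ultimately show ?thesis
    by (simp add: l_def)
qed

section \<open>Genericity of distinct root products\<close>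

text \<open>Each root \<open>w\<close> satisfies \<open>x = f w\<close>. So the bad values of
  \<open>x\<close> are 0 and the values of \<open>f\<close> at the zeros of finitely many nonzero
  polynomials: \<open>q1\<close>, which detects multiple roots, and \<open>q r\<close>, which
  detects a pair of roots with ratio \<open>r\<close>.\<close>

lemma trinomial_generic_roots:
  fixes b1 b2 :: complex
  assumes n: "2 \<le> n" and nz: "b1 \<noteq> 0" "b2 \<noteq> 0" and T: "finite T" "1 \<notin> T"
  shows "eventually (\<lambda>x. x \<noteq> 0 \<and> (\<exists>w. inj_on w {..<n} \<and>
      (\<forall>j<n. x + b1 * w j + b2 * w j ^ n = 0) \<and>
      (\<forall>j<n. \<forall>j'<n. \<forall>r\<in>T. w j \<noteq> r * w j'))) cofinite"
proof -
  define f where "f w = - (b1 * w + b2 * w ^ n)" for w :: complex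
  \<comment> \<open>The value of \<open>q r\<close> at \<open>w\<close>, times \<open>w\<close>, is
    the difference of the trinomial at \<open>w\<close> and at \<open>r * w\<close>. The constant
    coefficient \<open>b1 * (1 - r)\<close> is nonzero because 1 is not in \<open>T\<close>.\<close>
  define q where "q r = [:b1 * (1 - r):] + monom (b2 * (1 - r ^ n)) (n - 1)" for r
  define q1 where "q1 = [:b1:] + monom (of_nat n * b2) (n - 1)"
  have "Polynomial.coeff (q r) 0 \<noteq> 0" if "r \<in> T" for r
    using that T(2) n nz by (auto simp: q_def)
  then have q: "q r \<noteq> 0" if "r \<in> T" for r using that by force
  have "Polynomial.coeff q1 0 \<noteq> 0" using n nz by (auto simp: q1_def)
  then have q1: "q1 \<noteq> 0" by force
  define bad where "bad = {0} \<union> f ` {w. poly q1 w = 0} \<union> (\<Union>r\<in>T. f ` {w. poly (q r) w = 0})"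
  have "finite bad"
    unfolding bad_def using T(1) poly_roots_finite[OF q1] poly_roots_finite[OF q] by auto
  moreover have "x \<noteq> 0 \<and> (\<exists>w. inj_on w {..<n} \<and>
      (\<forall>j<n. x + b1 * w j + b2 * w j ^ n = 0) \<and>
      (\<forall>j<n. \<forall>j'<n. \<forall>r\<in>T. w j \<noteq> r * w j'))" if x: "x \<notin> bad" for x
  proof -
    have x0: "x \<noteq> 0" using x by (auto simp: bad_def)
    define p where "p = [:x, b1:] + monom b2 n"
    have pv: "poly p w = x + b1 * w + b2 * w ^ n" for w
      by (simp add: p_def poly_monom)
    have root: "x = f w" if "poly p w = 0" for w
      using that by (simp add: pv f_def add.assoc eq_neg_iff_add_eq_0 del: minus_add_distrib)
    have deg: "degree p = n"
    proof -
      have "degree p = degree (monom b2 n)"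
        unfolding p_def using n nz by (intro degree_add_eq_right) (simp add: degree_monom_eq)
      then show ?thesis using nz by (simp add: degree_monom_eq)
    qed
    have "pderiv p = q1"
      using nz by (simp add: p_def q1_def pderiv_add pderiv_pCons pderiv_monom)
    then have "rsquarefree p"
      unfolding rsquarefree_roots using x root by (auto simp: bad_def)
    have p0: "p \<noteq> 0" using deg n by auto
    let ?Z = "{w. poly p w = 0}"
    \<comment> \<open>A squarefree polynomial is, up to its leading coefficient, the product over
      its root set, so there are exactly \<open>n\<close> roots.\<close>
    have "degree (Polynomial.smult (lead_coeff p) (\<Prod>w\<in>?Z. [:- w, 1:])) = degree p"
      using complex_poly_decompose_rsquarefree[OF \<open>rsquarefree p\<close>] by simp
    moreover have "degree (\<Prod>w\<in>?Z. [:- w, 1:]) = card ?Z"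
      by (subst degree_prod_sum_eq) auto
    ultimately have card: "card ?Z = n"
      using p0 deg leading_coeff_0_iff[of p] by simp
    then obtain w where "bij_betw w {0..<n} ?Z"
      using ex_bij_betw_nat_finite[OF poly_roots_finite[OF p0]] by blast
    then have w: "inj_on w {..<n}" "\<And>j. j < n \<Longrightarrow> poly p (w j) = 0"
      by (auto simp: bij_betw_def atLeast0LessThan)
    have "w j \<noteq> r * w j'" if jj: "j < n" "j' < n" "r \<in> T" for j j' r
    proof
      assume eq: "w j = r * w j'"
      have r: "x + b1 * w j' + b2 * w j' ^ n = 0" "x + b1 * (r * w j') + b2 * (r * w j') ^ n = 0"
        using w(2)[OF jj(1)] w(2)[OF jj(2)] by (auto simp: pv eq)
      then have "w j' \<noteq> 0" using x0 n by (auto simp: zero_power)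
      have "w j' * poly (q r) (w j') = (x + b1 * w j' + b2 * w j' ^ n) - (x + b1 * (r * w j') + b2 * (r * w j') ^ n)"
        using n by (cases n) (auto simp: q_def poly_monom algebra_simps power_mult_distrib)
      then have "poly (q r) (w j') = 0" using r \<open>w j' \<noteq> 0\<close> by simp
      moreover have "x = f (w j')" using root w(2)[OF jj(2)] by simp
      ultimately show False using x jj(3) by (auto simp: bad_def)
    qed
    then show ?thesis using x0 w by (auto simp: pv)
  qed
  ultimately show ?thesis
    unfolding eventually_cofinite by (elim rev_finite_subset) blast
qed

text \<open>The set \<open>J\<close> is a parameter so that it can grow one index at a time. When it
  is everything, distinct products make the zeros of the resultant in \<open>A0\<close>
  distinct.\<close>

definition simple_roots :: "('i::finite \<Rightarrow> nat) \<Rightarrow> 'i set \<Rightarrow> ('i coeff \<Rightarrow> complex) \<Rightarrow> ('i \<Rightarrow> nat \<Rightarrow> complex) \<Rightarrow> bool" where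
  "simple_roots \<alpha> J c z \<longleftrightarrow>
     (\<forall>i\<in>J. c (B0 i) \<noteq> 0 \<and> inj_on (z i) {..<\<alpha> i} \<and>
        (\<forall>j<\<alpha> i. c (B0 i) + c (B1 i) * z i j + c (B2 i) * z i j ^ \<alpha> i = 0)) \<and>
     inj_on (\<lambda>s. \<Prod>i\<in>J. z i (s i)) (PiE J (\<lambda>i. {..<\<alpha> i}))"

text \<open>The coefficients \<open>B0 i\<close> are left free: they are chosen last, and
  \<open>simple_roots\<close> makes them nonzero.\<close>

definition nondegenerate :: "('i::finite coeff \<Rightarrow> complex) \<Rightarrow> bool" where
  "nondegenerate c \<longleftrightarrow> c A0 \<noteq> 0 \<and> c A1 \<noteq> 0 \<and> (\<forall>i. c (B1 i) \<noteq> 0 \<and> c (B2 i) \<noteq> 0)"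

lemma simple_roots_nonzero:
  assumes "simple_roots \<alpha> J c z" "i \<in> J" "j < \<alpha> i"
  shows "z i j \<noteq> 0"
proof
  assume "z i j = 0"
  with assms have "c (B0 i) \<noteq> 0" "c (B0 i) + c (B2 i) * 0 ^ \<alpha> i = 0"
    by (auto simp: simple_roots_def) (metis mult_zero_right add.right_neutral)
  with assms(3) show False by (simp add: zero_power)
qed

text \<open>If two products over \<open>insert i J\<close> agree, the ratio of the new roots is a
  quotient of two old products. Quotients other than 1 are excluded by the choice of
  \<open>x\<close>; the quotient 1 forces equal old tuples and then equal new roots.\<close>

lemma simple_roots_insert:
  assumes \<alpha>: "\<And>i. 2 \<le> \<alpha> i" and z: "simple_roots \<alpha> J c z" and i: "i \<notin> J"
    and nz: "c (B1 i) \<noteq> 0" "c (B2 i) \<noteq> 0"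
  shows "eventually (\<lambda>x. \<exists>z. simple_roots \<alpha> (insert i J) (c(B0 i := x)) z) cofinite"
proof -
  define pr where "pr s = (\<Prod>i\<in>J. z i (s i))" for s
  let ?S = "PiE J (\<lambda>i. {..<\<alpha> i})"
  have fin: "finite ?S" by (intro finite_PiE) auto
  have pr0: "pr s \<noteq> 0" if "s \<in> ?S" for s
    using that simple_roots_nonzero[OF z] by (auto simp: pr_def PiE_iff)
  define T where "T = (\<lambda>(s, s'). pr s' / pr s) ` (?S \<times> ?S) - {1}"
  have "finite T" "1 \<notin> T" using fin by (auto simp: T_def)
  from trinomial_generic_roots[OF \<alpha>[of i] nz this] show ?thesis
  proof (rule eventually_mono)
    fix x
    assume "x \<noteq> 0 \<and> (\<exists>w. inj_on w {..<\<alpha> i} \<and>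
      (\<forall>j<\<alpha> i. x + c (B1 i) * w j + c (B2 i) * w j ^ \<alpha> i = 0) \<and>
      (\<forall>j<\<alpha> i. \<forall>j'<\<alpha> i. \<forall>r\<in>T. w j \<noteq> r * w j'))"
    then obtain w where x: "x \<noteq> 0" and w: "inj_on w {..<\<alpha> i}"
      "\<And>j. j < \<alpha> i \<Longrightarrow> x + c (B1 i) * w j + c (B2 i) * w j ^ \<alpha> i = 0"
      "\<And>j j' r. j < \<alpha> i \<Longrightarrow> j' < \<alpha> i \<Longrightarrow> r \<in> T \<Longrightarrow> w j \<noteq> r * w j'"
      by blast
    define z' where "z' = z(i := w)"
    have w0: "w j \<noteq> 0" if "j < \<alpha> i" for j
      using w(2)[OF that] x that by (auto simp: zero_power)
    have pr': "(\<Prod>k\<in>insert i J. z' k (s k)) = w (s i) * pr (restrict s J)" for s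
      using i by (simp add: z'_def pr_def) (auto intro!: prod.cong)
    have "inj_on (\<lambda>s. \<Prod>k\<in>insert i J. z' k (s k)) (PiE (insert i J) (\<lambda>i. {..<\<alpha> i}))"
    proof (rule inj_onI)
      fix s s'
      assume s: "s \<in> PiE (insert i J) (\<lambda>i. {..<\<alpha> i})" "s' \<in> PiE (insert i J) (\<lambda>i. {..<\<alpha> i})"
        and "(\<Prod>k\<in>insert i J. z' k (s k)) = (\<Prod>k\<in>insert i J. z' k (s' k))"
      then have eq: "w (s i) * pr (restrict s J) = w (s' i) * pr (restrict s' J)"
        by (simp only: pr')
      have r: "restrict s J \<in> ?S" "restrict s' J \<in> ?S" and si: "s i < \<alpha> i" "s' i < \<alpha> i"
        using s by auto
      have "pr (restrict s J) = pr (restrict s' J)"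
      proof (rule ccontr)
        assume ne: "pr (restrict s J) \<noteq> pr (restrict s' J)"
        then have "pr (restrict s' J) / pr (restrict s J) \<in> T"
          using pr0[OF r(1)] unfolding T_def
            by (intro DiffI image_eqI[where x = "(restrict s J, restrict s' J)"] SigmaI r) auto
        from w(3)[OF si this] show False
          using eq pr0[OF r(1)] by (simp add: field_simps)
      qed
      with z r have rs: "restrict s J = restrict s' J"
        by (auto simp: simple_roots_def pr_def inj_on_def)
      have "w (s i) = w (s' i)" using eq rs pr0[OF r(2)] by simp
      with w(1) si have "s i = s' i" by (auto simp: inj_on_def)
      show "s = s'"
      proof (rule PiE_ext[OF s])
        fix k assume "k \<in> insert i J"
        then show "s k = s' k" using \<open>s i = s' i\<close> rs by (metis insertE restrict_apply')
      qed
    qed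
    moreover have "\<forall>k\<in>insert i J. (c(B0 i := x)) (B0 k) \<noteq> 0 \<and> inj_on (z' k) {..<\<alpha> k} \<and>
        (\<forall>j<\<alpha> k. (c(B0 i := x)) (B0 k) + (c(B0 i := x)) (B1 k) * z' k j + (c(B0 i := x)) (B2 k) * z' k j ^ \<alpha> k = 0)"
      using x w z i by (auto simp: z'_def simple_roots_def)
    ultimately show "\<exists>z. simple_roots \<alpha> (insert i J) (c(B0 i := x)) z"
      unfolding simple_roots_def by blast
  qed
qed

lemma generic_True: "generic vs (\<lambda>_. True) c"
  by (induction vs arbitrary: c) auto

lemma generic_nonzero:
  "finite W \<Longrightarrow> W \<subseteq> set vs \<Longrightarrow> generic vs (\<lambda>c. \<forall>v\<in>W. c v \<noteq> 0) c"
proof (induction W rule: finite_induct)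
  case (insert v W)
  have "Var v \<noteq> 0" "vars (Var v) = {v}"
    by (auto simp: Var_def vars_def)
  then have "generic vs (\<lambda>c. mev c (Var v) \<noteq> 0) c"
    using insert.prems by (intro generic_mev_nonzero) auto
  from generic_conj[OF this insert.IH] insert.prems show ?case
    by (auto elim: generic_mono)
qed (simp add: generic_True)

text \<open>The constant coefficients \<open>B0 i\<close> come last in the list, because the
  finitely many forbidden values of each depend on \<open>B1 i\<close>, \<open>B2 i\<close> and the
  roots at the indices treated before.\<close>

lemma generic_simple_roots:
  fixes \<alpha> :: "'i::finite \<Rightarrow> nat"
  assumes \<alpha>: "\<And>i. 2 \<le> \<alpha> i"
  shows "\<exists>vs. set vs = UNIV \<and> (\<forall>c. generic vs (\<lambda>c. nondegenerate c \<and> (\<exists>z. simple_roots \<alpha> UNIV c z)) c)"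
proof -
  obtain js :: "'i list" where js: "set js = UNIV" "distinct js"
    using finite_distinct_list[of "UNIV :: 'i set"] by auto
  define vs :: "'i coeff list" where "vs = [A0, A1] @ map B1 js @ map B2 js"
  have step: "generic (map B0 is) (\<lambda>c. nondegenerate c \<and> (\<exists>z. simple_roots \<alpha> (J \<union> set is) c z)) c"
    if "distinct is" "set is \<inter> J = {}" "nondegenerate c" "\<exists>z. simple_roots \<alpha> J c z" for "is" J c
    using that
  proof (induction "is" arbitrary: J c)
    case (Cons i "is")
    from Cons.prems obtain z where z: "simple_roots \<alpha> J c z" by blast
    have "eventually (\<lambda>x. \<exists>z. simple_roots \<alpha> (insert i J) (c(B0 i := x)) z) cofinite"
      using Cons.prems by (intro simple_roots_insert[OF \<alpha> z]) (auto simp: nondegenerate_def)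
    then show ?case
      unfolding list.map generic.simps
    proof (rule eventually_mono)
      fix x assume ex: "\<exists>z. simple_roots \<alpha> (insert i J) (c(B0 i := x)) z"
      have nd: "nondegenerate (c(B0 i := x))"
        using Cons.prems by (auto simp: nondegenerate_def)
      have "generic (map B0 is) (\<lambda>c. nondegenerate c \<and> (\<exists>z. simple_roots \<alpha> (insert i J \<union> set is) c z)) (c(B0 i := x))"
      proof (rule Cons.IH)
        show "distinct is" "set is \<inter> insert i J = {}" using Cons.prems by auto
      qed (rule nd, rule ex)
      then show "generic (map B0 is) (\<lambda>c. nondegenerate c \<and> (\<exists>z. simple_roots \<alpha> (J \<union> set (i # is)) c z)) (c(B0 i := x))"
        by simp
    qed
  qed auto
  have "generic (vs @ map B0 js) (\<lambda>c. nondegenerate c \<and> (\<exists>z. simple_roots \<alpha> UNIV c z)) c" for c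
    unfolding generic_append
  proof (rule generic_mono)
    show "generic vs (\<lambda>c. \<forall>v\<in>set vs. c v \<noteq> 0) c"
      by (rule generic_nonzero) auto
    fix c :: "'i coeff \<Rightarrow> complex" assume "\<forall>v\<in>set vs. c v \<noteq> 0"
    then have "nondegenerate c" by (auto simp: vs_def nondegenerate_def js)
    moreover have "simple_roots \<alpha> {} c (\<lambda>_ _. 0)" by (simp add: simple_roots_def)
    ultimately show "generic (map B0 js) (\<lambda>c. nondegenerate c \<and> (\<exists>z. simple_roots \<alpha> UNIV c z)) c"
      using step[of js "{}" c] js by auto
  qed
  moreover have "set (vs @ map B0 js) = UNIV"
  proof -
    have "v \<in> set (vs @ map B0 js)" for v by (cases v) (auto simp: vs_def js)
    then show ?thesis by blast
  qed
  ultimately show ?thesis by blast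
qed

section \<open>The resultant is unique up to sign\<close>

lemma simple_roots_pencil_det:
  fixes \<alpha> :: "'i::finite \<Rightarrow> nat"
  assumes "\<And>i. 2 \<le> \<alpha> i" "simple_roots \<alpha> UNIV c z"
  shows "mev (c(A0 := x)) (quiver_res \<alpha>) = (\<Prod>i\<in>UNIV. c (B2 i) ^ (\<Prod>k\<in>UNIV - {i}. \<alpha> k)) *
     (\<Prod>s\<in>idx \<alpha>. x + c A1 * (\<Prod>i\<in>UNIV. z i (s i)))"
  unfolding mev_quiver_res using assms
  by (subst pencil_det_eq_prod_roots[where z = z]) (auto simp: simple_roots_def)

text \<open>\<open>B2 i\<close> enters the pencil only multiplied by \<open>A0\<close>. At
  \<open>A0 = 0\<close> the substitution of 0 for \<open>B2 i\<close> therefore changes nothing, and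
  the value there is a product of nonzero roots and coefficients.\<close>

lemma subst0_B2_quiver_res_nonzero:
  fixes \<alpha> :: "'i::finite \<Rightarrow> nat"
  assumes \<alpha>: "\<And>i. 2 \<le> \<alpha> i"
  shows "subst0 (B2 i) (quiver_res \<alpha>) \<noteq> 0"
proof -
  obtain vs where vs: "\<And>c. generic vs (\<lambda>c. nondegenerate c \<and> (\<exists>z. simple_roots \<alpha> UNIV c z)) c"
    using generic_simple_roots[of \<alpha>, OF \<alpha>] by blast
  from vs[of "\<lambda>_. 0"] obtain c z where c: "nondegenerate c" "simple_roots \<alpha> UNIV c z"
    by (auto elim: generic_ex)
  have "mev (c(A0 := 0)) (subst0 (B2 i) (quiver_res \<alpha>)) = mev (c(A0 := 0)) (quiver_res \<alpha>)"
    by (simp add: mev_subst0 mev_quiver_res pencil_det_def)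
  also have "\<dots> \<noteq> 0"
    unfolding simple_roots_pencil_det[of \<alpha>, OF \<alpha> c(2)]
    using c simple_roots_nonzero[OF c(2)] by (auto simp: nondegenerate_def idx_iff)
  finally show ?thesis by auto
qed

lemma quiver_res_dvd_cancel:
  fixes \<alpha> :: "'i::finite \<Rightarrow> nat"
  assumes \<alpha>: "\<And>i. 2 \<le> \<alpha> i" and "finite J"
    and "quiver_res \<alpha> dvd (\<Prod>i\<in>J. Var (B2 i) ^ e i) * X"
  shows "quiver_res \<alpha> dvd X"
proof -
  have pow: "quiver_res \<alpha> dvd Y" if "quiver_res \<alpha> dvd Var (B2 i) ^ n * Y" for i n Y
    using that
  proof (induction n)
    case (Suc n)
    have "quiver_res \<alpha> dvd Var (B2 i) * (Var (B2 i) ^ n * Y)"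
      using Suc.prems by (simp add: mult.assoc)
    then show ?case
      using Suc.IH subst0_dvd_cancel[OF subst0_B2_quiver_res_nonzero[of \<alpha>, OF \<alpha>]] by blast
  qed auto
  show ?thesis
    using assms(2,3)
  proof (induction J rule: finite_induct)
    case (insert i J)
    then have "quiver_res \<alpha> dvd Var (B2 i) ^ e i * ((\<Prod>i\<in>J. Var (B2 i) ^ e i) * X)"
      by (simp add: mult.assoc)
    then show ?case using insert.IH pow by blast
  qed auto
qed

lemma solvable_of_simple_roots:
  fixes \<alpha> :: "'i::finite \<Rightarrow> nat"
  assumes c: "nondegenerate c" "simple_roots \<alpha> UNIV c z" and s: "s \<in> idx \<alpha>"
  shows "c(A0 := - c A1 * (\<Prod>i\<in>UNIV. z i (s i))) \<in> solvable_coeffs \<alpha>"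
proof -
  let ?c = "c(A0 := - c A1 * (\<Prod>i\<in>UNIV. z i (s i)))"
  have z: "z i (s i) \<noteq> 0" for i
    using s simple_roots_nonzero[OF c(2)] by (auto simp: idx_iff)
  have "?c v \<noteq> 0" for v
    using c z by (cases v) (auto simp: nondegenerate_def simple_roots_def)
  moreover have "\<forall>i. ?c (B0 i) + ?c (B1 i) * z i (s i) + ?c (B2 i) * z i (s i) ^ \<alpha> i = 0"
    using c s by (auto simp: simple_roots_def idx_iff)
  ultimately show ?thesis
    using z by (auto simp: solvable_coeffs_def intro!: exI[of _ "\<lambda>i. z i (s i)"])
qed

lemma quiver_res_dvd:
  fixes \<alpha> :: "'i::finite \<Rightarrow> nat"
  assumes \<alpha>: "\<And>i. 2 \<le> \<alpha> i"
    and van: "\<And>c. c \<in> solvable_coeffs \<alpha> \<Longrightarrow> mev c R = 0"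
  shows "quiver_res \<alpha> dvd R"
proof -
  let ?G = "\<lambda>c. nondegenerate c \<and> (\<exists>z. simple_roots \<alpha> UNIV c z)"
  obtain vs where vs: "set vs = UNIV" "\<And>c. generic vs ?G c"
    using generic_simple_roots[of \<alpha>, OF \<alpha>] by blast
  \<comment> \<open>\<open>B\<close> is the leading coefficient of the resultant in
    \<open>A0\<close> and \<open>n\<close> its degree; both are read off from the product over the
    roots at generic points.\<close>
  define B :: "'i coeff mpoly" where "B = (\<Prod>i\<in>UNIV. Var (B2 i) ^ (\<Prod>k\<in>UNIV - {i}. \<alpha> k))"
  define n where "n = card (idx \<alpha>)"
  define F where "F = univariate A0 (quiver_res \<alpha>)"
  have mevB: "mev c B = (\<Prod>i\<in>UNIV. c (B2 i) ^ (\<Prod>k\<in>UNIV - {i}. \<alpha> k))" for c :: "'i coeff \<Rightarrow> complex"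
    by (simp add: B_def mev.hom_prod mev.hom_power)
  have F: "map_poly (mev c) F = Polynomial.smult (mev c B) (\<Prod>s\<in>idx \<alpha>. [:c A1 * (\<Prod>i\<in>UNIV. z i (s i)), 1:])"
    if "simple_roots \<alpha> UNIV c z" for c z
    unfolding F_def
    by (rule poly_ext)
       (simp add: poly_map_univariate simple_roots_pencil_det[of \<alpha>, OF \<alpha> that] poly_prod mevB add.commute)
  have degF: "degree (map_poly (mev c) F) = n \<and> Polynomial.coeff (map_poly (mev c) F) n = mev c B"
    if c: "?G c" for c
  proof -
    obtain z where "simple_roots \<alpha> UNIV c z" using c by blast
    note F = F[OF this]
    have "mev c B \<noteq> 0" using c by (auto simp: mevB nondegenerate_def)
    then have 1: "degree (map_poly (mev c) F) = n"
      by (simp add: F n_def degree_prod_sum_eq)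
    have "lead_coeff (map_poly (mev c) F) = mev c B"
      unfolding F by (simp add: lead_coeff_smult lead_coeff_prod)
    with 1 show ?thesis by simp
  qed
  have cF: "Polynomial.coeff F n = B"
    using vs degF by (intro mev_generic_eqI[where G = ?G]) (auto simp: coeff_map_poly)
  have coeff_0: "Polynomial.coeff f j = 0" if f: "\<And>c. ?G c \<Longrightarrow> Polynomial.coeff (map_poly (mev c) f) j = 0" for f j
  proof (rule mev_generic_eqI[OF vs(2) vs(1)])
    fix c assume "?G c"
    from f[OF this] show "mev c (Polynomial.coeff f j) = mev c 0" by (simp add: coeff_map_poly)
  qed
  have "B \<noteq> 0"
    using mevB[of "\<lambda>_. 1"] by auto
  have dF: "degree F = n"
  proof (rule antisym)
    show "degree F \<le> n"
    proof (rule degree_le, intro allI impI)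
      fix j assume "n < j"
      then show "Polynomial.coeff F j = 0"
        using degF by (intro coeff_0 coeff_eq_0) auto
    qed
    show "n \<le> degree F"
      using cF \<open>B \<noteq> 0\<close> by (intro le_degree) auto
  qed
  have "F \<noteq> 0" using cF \<open>B \<noteq> 0\<close> by auto
  \<comment> \<open>Pseudo-division avoids inverting the leading coefficient; it costs only the
    factor \<open>B ^ k\<close>.\<close>
  obtain Q r where Qr: "pseudo_divmod (univariate A0 R) F = (Q, r)" by fastforce
  define k where "k = Suc (degree (univariate A0 R)) - n"
  from pseudo_divmod[OF \<open>F \<noteq> 0\<close> Qr]
  have eq: "Polynomial.smult (B ^ k) (univariate A0 R) = F * Q + r" and dr: "r = 0 \<or> degree r < n"
    by (auto simp: dF cF k_def)
  \<comment> \<open>At a generic point \<open>R\<close> and \<open>F\<close> vanish at the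
    \<open>n\<close> distinct values \<open>?f s\<close> of \<open>A0\<close>, hence so does the
    remainder, whose degree is below \<open>n\<close>.\<close>
  have "map_poly (mev c) r = 0" if c: "?G c" for c
  proof (rule ccontr)
    assume nz: "map_poly (mev c) r \<noteq> 0"
    obtain z where z: "simple_roots \<alpha> UNIV c z" using c by blast
    interpret map_poly_comm_ring_hom "mev c" ..
    let ?f = "\<lambda>s. - c A1 * (\<Prod>i\<in>UNIV. z i (s i))"
    have "poly (map_poly (mev c) r) (?f s) = 0" if s: "s \<in> idx \<alpha>" for s
    proof -
      have "mev (c(A0 := ?f s)) R = 0"
        using solvable_of_simple_roots[OF _ z s] c van by blast
      then have "poly (map_poly (mev c) (univariate A0 R)) (?f s) = 0"
        by (simp add: poly_map_univariate)
      moreover have "poly (map_poly (mev c) F) (?f s) = 0"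
        using s by (auto simp: F[OF z] poly_prod intro!: bexI[of _ s])
      moreover have "Polynomial.smult (mev c (B ^ k)) (map_poly (mev c) (univariate A0 R)) =
          map_poly (mev c) F * map_poly (mev c) Q + map_poly (mev c) r"
        unfolding mev.map_poly_hom_smult[symmetric] eq by (simp only: hom_add hom_mult)
      from arg_cong[OF this, of "\<lambda>p. poly p (?f s)"]
      have "mev c (B ^ k) * poly (map_poly (mev c) (univariate A0 R)) (?f s) =
          poly (map_poly (mev c) F) (?f s) * poly (map_poly (mev c) Q) (?f s) + poly (map_poly (mev c) r) (?f s)"
        by (simp only: poly_add poly_mult poly_smult)
      ultimately show ?thesis by simp
    qed
    then have sub: "?f ` idx \<alpha> \<subseteq> {x. poly (map_poly (mev c) r) x = 0}" by auto
    have "inj_on ?f (idx \<alpha>)"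
      using z c by (auto simp: simple_roots_def idx_def inj_on_def nondegenerate_def)
    then have "n = card (?f ` idx \<alpha>)"
      unfolding n_def by (rule card_image[symmetric])
    also have "\<dots> \<le> card {x. poly (map_poly (mev c) r) x = 0}"
      by (rule card_mono[OF poly_roots_finite[OF nz] sub])
    also have "\<dots> \<le> degree (map_poly (mev c) r)"
      by (rule poly_roots_degree[OF nz])
    also have "\<dots> \<le> degree r" by (rule degree_map_poly_le)
    finally show False using dr nz by auto
  qed
  then have "Polynomial.coeff r j = 0" for j
    by (intro coeff_0) simp
  then have "r = 0" by (simp add: poly_eqI)
  \<comment> \<open>Putting \<open>Var A0\<close> back for the indeterminate returns to
    \<open>R\<close> and the resultant.\<close>
  with eq have "poly (Polynomial.smult (B ^ k) (univariate A0 R)) (Var A0) = poly (F * Q) (Var A0)" by simp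
  then have "B ^ k * R = quiver_res \<alpha> * poly Q (Var A0)"
    by (simp add: poly_univariate_Var F_def)
  then have "quiver_res \<alpha> dvd (\<Prod>i\<in>UNIV. Var (B2 i) ^ ((\<Prod>k\<in>UNIV - {i}. \<alpha> k) * k)) * R"
    by (simp add: B_def prod_power_distrib power_mult)
  then show ?thesis by (rule quiver_res_dvd_cancel[OF \<alpha> finite])
qed

text \<open>\<open>quiver_res \<alpha>\<close> divides \<open>R\<close> and has a complex zero, so
  it is not a unit; irreducibility of \<open>R\<close> then makes the cofactor a unit, that is 1 or
  -1.\<close>

theorem refined_quiver_resultant_unique:
  fixes \<alpha> :: "'i::finite \<Rightarrow> nat"
  assumes \<alpha>: "\<And>i. 2 \<le> \<alpha> i" and R: "is_refined_quiver_resultant \<alpha> R"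
  shows "R = quiver_res \<alpha> \<or> R = - quiver_res \<alpha>"
proof -
  have "mev c R = 0" if "c \<in> solvable_coeffs \<alpha>" for c
    using R that closure_subset[of "solvable_coeffs \<alpha>"]
    by (auto simp: is_refined_quiver_resultant_def poly_eval_eq_mev)
  then have "quiver_res \<alpha> dvd R" by (rule quiver_res_dvd[OF \<alpha>])
  then obtain S where S: "R = quiver_res \<alpha> * S" by (rule dvdE)
  have "\<not> quiver_res \<alpha> dvd 1"
  proof
    assume "quiver_res \<alpha> dvd 1"
    then obtain T where T: "1 = quiver_res \<alpha> * T" by (rule dvdE)
    obtain vs where "generic vs (\<lambda>c. nondegenerate c \<and> (\<exists>z. simple_roots \<alpha> UNIV c z)) (\<lambda>_. 0)"
      using generic_simple_roots[of \<alpha>, OF \<alpha>] by blast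
    then obtain c z where c: "nondegenerate c" "simple_roots \<alpha> UNIV c z"
      by (auto elim: generic_ex)
    have s: "(\<lambda>_. 0) \<in> idx \<alpha>" using \<alpha> by (auto simp: idx_iff intro: less_le_trans[of 0 2])
    have "mev (c(A0 := - c A1 * (\<Prod>i\<in>UNIV. z i 0))) (quiver_res \<alpha>) = 0"
      unfolding simple_roots_pencil_det[of \<alpha>, OF \<alpha> c(2)] using s by (auto intro!: bexI[of _ "\<lambda>_. 0"])
    moreover have "mev (c(A0 := - c A1 * (\<Prod>i\<in>UNIV. z i 0))) (quiver_res \<alpha> * T) = 1"
      using T by (metis mev_1)
    ultimately show False by (simp add: mev_mult)
  qed
  then have "S dvd 1"
    using R irreducibleD[of R "quiver_res \<alpha>" S] S by (auto simp: is_refined_quiver_resultant_def)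
  then show ?thesis using mpoly_unit[of S] S by auto
qed

section \<open>Asymptotics of the roots\<close>

text \<open>Up to the leading coefficient, the absolute value of \<open>poly p x\<close> is the
  product of the distances from \<open>x\<close> to the roots, and each of them is at least the
  smallest one.\<close>

lemma nearest_root:
  fixes p :: "complex poly"
  assumes "0 < degree p"
  obtains y where "poly p y = 0" "cmod (lead_coeff p) * cmod (x - y) ^ degree p \<le> cmod (poly p x)"
proof -
  obtain root where root: "Polynomial.smult (lead_coeff p) (\<Prod>i<degree p. [:- root i, 1:]) = p"
    by (rule complex_poly_decompose')
  have pv: "poly p y = lead_coeff p * (\<Prod>i<degree p. y - root i)" for y
    by (subst root[symmetric]) (simp add: poly_prod)
  obtain i where i: "i < degree p" "\<And>j. j < degree p \<Longrightarrow> cmod (x - root i) \<le> cmod (x - root j)"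
    using ex_min_if_finite[of "(\<lambda>j. cmod (x - root j)) ` {..<degree p}"] assms
    by (auto simp: not_less)
  have "cmod (x - root i) ^ degree p = (\<Prod>j<degree p. cmod (x - root i))" by simp
  also have "\<dots> \<le> (\<Prod>j<degree p. cmod (x - root j))"
    using i by (intro prod_mono) auto
  finally have "cmod (lead_coeff p) * cmod (x - root i) ^ degree p \<le> cmod (poly p x)"
    unfolding pv[of x] by (simp add: norm_mult prod_norm mult_left_mono)
  moreover have "poly p (root i) = 0"
    using i(1) by (auto simp: pv)
  ultimately show thesis using that by blast
qed

text \<open>The substitution \<open>z = k * y\<close> turns the scaled trinomial into a multiple of
  \<open>b0 / k + b1 * y + b2 * y ^ n\<close>. Its limit has the simple roots 0 and the solutions of
  \<open>y ^ (n - 1) = - b1 / b2\<close>, and each attracts one root. Index 0 belongs to the root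
  near 0, which still converges after multiplication by \<open>k\<close>.\<close>

lemma trinomial_root_asymptotics:
  fixes b0 b1 b2 :: complex
  assumes n: "2 \<le> n" and nz: "b0 \<noteq> 0" "b1 \<noteq> 0" "b2 \<noteq> 0"
  obtains y :: "nat \<Rightarrow> nat \<Rightarrow> complex" and r :: "nat \<Rightarrow> complex"
  where "bij_betw r {1..<n} {w. w ^ (n - 1) = - b1 / b2}"
    and "\<And>k j. 0 < k \<Longrightarrow> j < n \<Longrightarrow> b0 / of_nat k + b1 * y k j + b2 * y k j ^ n = 0"
    and "\<And>j. 0 < j \<Longrightarrow> j < n \<Longrightarrow> (\<lambda>k. y k j) \<longlonglongrightarrow> r j"
    and "(\<lambda>k. of_nat k * y k 0) \<longlonglongrightarrow> - b0 / b1"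
    and "eventually (\<lambda>k. inj_on (y k) {..<n}) sequentially"
proof -
  define W where "W = {w :: complex. w ^ (n - 1) = - b1 / b2}"
  have W: "finite W" "card W = n - 1"
    unfolding W_def using n nz by (auto intro!: card_nth_roots finite_nth_roots)
  obtain r' where r': "bij_betw r' {0..<n - 1} W"
    using ex_bij_betw_nat_finite[OF W(1)] W(2) by auto
  define r where "r j = (if j = 0 then 0 else r' (j - 1))" for j
  have "bij_betw (\<lambda>j. j - 1) {1..<n} {0..<n - 1}"
    by (rule bij_betwI[where g = Suc]) auto
  from bij_betw_trans[OF this r'] have bij: "bij_betw r {1..<n} W"
    by (rule iffD1[OF bij_betw_cong, rotated]) (auto simp: r_def)
  have rW: "r j \<in> W" if "0 < j" "j < n" for j
    using bij_betwE[OF bij] that by auto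
  have r0: "r j \<noteq> 0" if "0 < j" "j < n" for j
    using rW[OF that] n nz by (auto simp: W_def zero_power)
  have r_root: "b1 * r j + b2 * r j ^ n = 0" if "j < n" for j
  proof (cases "j = 0")
    case False
    then have "r j ^ (n - 1) = - b1 / b2" using rW that by (auto simp: W_def)
    moreover have "r j ^ n = r j * r j ^ (n - 1)" using n by (cases n) auto
    ultimately show ?thesis using nz by simp
  qed (use n in \<open>simp add: r_def zero_power\<close>)
  have r_inj: "inj_on r {..<n}"
  proof (rule inj_onI)
    fix i j assume ij: "i \<in> {..<n}" "j \<in> {..<n}" "r i = r j"
    have rr: "r 0 = 0" by (simp add: r_def)
    show "i = j"
    proof (cases "i = 0 \<or> j = 0")
      case True
      then show ?thesis using ij r0 rr by (metis lessThan_iff neq0_conv)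
    next
      case False
      then show ?thesis using ij bij by (auto simp: bij_betw_def inj_on_def)
    qed
  qed
  define p where "p k = [:b0 / of_nat k, b1:] + monom b2 n" for k :: nat
  have deg: "degree (p k) = n" and lead: "lead_coeff (p k) = b2" for k
  proof -
    have lt: "degree [:b0 / of_nat k, b1:] < degree (monom b2 n)"
      using n nz by (simp add: degree_monom_eq)
    then show "degree (p k) = n"
      unfolding p_def using nz by (simp add: degree_add_eq_right degree_monom_eq)
    show "lead_coeff (p k) = b2"
      unfolding p_def lead_coeff_add_le[OF lt] by (simp add: degree_monom_eq nz)
  qed
  \<comment> \<open>\<open>y k j\<close> is a root close to \<open>r j\<close>. Different
    \<open>j\<close> might at first pick the same root; for large \<open>k\<close> this is excluded
    below, because the limits are distinct.\<close>
  have "\<exists>y. poly (p k) y = 0 \<and> cmod b2 * cmod (r j - y) ^ n \<le> cmod (poly (p k) (r j))" for k j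
    by (rule nearest_root[of "p k" "r j"]) (use n in \<open>auto simp: deg lead[unfolded deg]\<close>)
  then obtain y where y: "\<And>k j. poly (p k) (y k j) = 0"
      "\<And>k j. cmod b2 * cmod (r j - y k j) ^ n \<le> cmod (poly (p k) (r j))"
    by metis
  have pv: "poly (p k) w = b0 / of_nat k + b1 * w + b2 * w ^ n" for k w
    by (simp add: p_def poly_monom)
  have lim: "(\<lambda>k. y k j) \<longlonglongrightarrow> r j" if j: "j < n" for j
  proof -
    \<comment> \<open>Since \<open>r j\<close> is a root of the limit,
      \<open>poly (p k) (r j)\<close> is \<open>b0 / of_nat k\<close>, so the \<open>n\<close>-th
      power of the distance is at most a constant over \<open>k\<close>. At \<open>k = 0\<close>
      both quotients are 0 by the convention for division by zero.\<close>
    let ?e = "\<lambda>k. root n (cmod (b0 / b2) / real k)"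
    have le: "norm (y k j - r j) \<le> ?e k" for k
    proof -
      have "cmod b2 * cmod (y k j - r j) ^ n \<le> cmod (b0 / of_nat k)"
        using y(2)[of j k] r_root[OF j] by (simp add: pv norm_minus_commute add.assoc)
      then have "cmod (y k j - r j) ^ n \<le> cmod (b0 / of_nat k) / cmod b2"
        using nz by (subst pos_le_divide_eq) (auto simp: mult.commute)
      also have "\<dots> = cmod (b0 / b2) / real k"
        by (simp add: norm_divide)
      finally have "cmod (y k j - r j) ^ n \<le> cmod (b0 / b2) / real k" .
      then have "root n (cmod (y k j - r j) ^ n) \<le> ?e k"
        using n by (intro real_root_le_mono) auto
      then show ?thesis using n by (simp add: real_root_power_cancel)
    qed
    have "?e \<longlonglongrightarrow> root n 0"
      by (intro tendsto_real_root lim_const_over_n)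
    then have e: "?e \<longlonglongrightarrow> 0" by (simp only: real_root_zero)
    have "(\<lambda>k. y k j - r j) \<longlonglongrightarrow> 0"
      by (rule Lim_null_comparison[OF always_eventually e]) (rule allI, rule le)
    then show ?thesis by (rule LIM_zero_cancel)
  qed
  have "eventually (\<lambda>k. \<forall>i<n. \<forall>j<n. i \<noteq> j \<longrightarrow> y k i \<noteq> y k j) sequentially"
  proof -
    have "eventually (\<lambda>k. \<forall>ij\<in>{..<n} \<times> {..<n}. fst ij \<noteq> snd ij \<longrightarrow> y k (fst ij) \<noteq> y k (snd ij)) sequentially"
    proof (intro eventually_ball_finite ballI)
      fix ij assume ij: "ij \<in> {..<n} \<times> {..<n}"
      show "eventually (\<lambda>k. fst ij \<noteq> snd ij \<longrightarrow> y k (fst ij) \<noteq> y k (snd ij)) sequentially"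
      proof (cases "fst ij = snd ij")
        case False
        then have "r (fst ij) - r (snd ij) \<noteq> 0"
          using ij r_inj by (auto simp: inj_on_def)
        moreover have "(\<lambda>k. y k (fst ij) - y k (snd ij)) \<longlonglongrightarrow> r (fst ij) - r (snd ij)"
          using ij by (intro tendsto_diff lim) auto
        ultimately have "eventually (\<lambda>k. y k (fst ij) - y k (snd ij) \<noteq> 0) sequentially"
          by (intro tendsto_imp_eventually_ne)
        then show ?thesis by (auto elim: eventually_mono)
      qed auto
    qed auto
    then show ?thesis by (auto elim!: eventually_mono)
  qed
  then have inj: "eventually (\<lambda>k. inj_on (y k) {..<n}) sequentially"
    by (rule eventually_mono) (auto simp: inj_on_def)
  have lim0: "(\<lambda>k. y k 0) \<longlonglongrightarrow> 0" using lim[of 0] n by (simp add: r_def)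
  have den: "(\<lambda>k. b1 + b2 * y k 0 ^ (n - 1)) \<longlonglongrightarrow> b1 + b2 * 0 ^ (n - 1)"
    by (intro tendsto_intros lim0)
  then have den: "(\<lambda>k. b1 + b2 * y k 0 ^ (n - 1)) \<longlonglongrightarrow> b1"
    using n by (simp add: zero_power)
  \<comment> \<open>The root equation says that \<open>y k 0\<close> times this denominator is
    \<open>- b0 / of_nat k\<close>, and the denominator tends to \<open>b1\<close>.\<close>
  have "eventually (\<lambda>k. - b0 / (b1 + b2 * y k 0 ^ (n - 1)) = of_nat k * y k 0) sequentially"
    using tendsto_imp_eventually_ne[OF den nz(2)] eventually_gt_at_top[of 0]
  proof eventually_elim
    case (elim k)
    have "b0 / of_nat k + y k 0 * (b1 + b2 * y k 0 ^ (n - 1)) = 0"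
      using y(1)[of k 0] n unfolding pv by (cases n) (auto simp: algebra_simps)
    then have "b0 + of_nat k * y k 0 * (b1 + b2 * y k 0 ^ (n - 1)) = 0"
      using elim by (simp add: field_simps)
    then have "of_nat k * y k 0 * (b1 + b2 * y k 0 ^ (n - 1)) = - b0"
      by (simp only: add_eq_0_iff)
    then show ?case
      using elim(1) by (metis nonzero_mult_div_cancel_right)
  qed
  moreover have "(\<lambda>k. - b0 / (b1 + b2 * y k 0 ^ (n - 1))) \<longlonglongrightarrow> - b0 / b1"
    by (intro tendsto_divide tendsto_const den nz)
  ultimately have "(\<lambda>k. of_nat k * y k 0) \<longlonglongrightarrow> - b0 / b1"
    by (rule Lim_transform_eventually[rotated])
  then show thesis
    using that[of r y] bij lim inj y(1) unfolding W_def pv by blast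
qed

section \<open>Limits of the resultant along a one-parameter subgroup\<close>

definition quiver_weight :: "('i \<Rightarrow> nat) \<Rightarrow> nat \<Rightarrow> 'i coeff \<Rightarrow> nat" where
  "quiver_weight \<alpha> q v = (case v of A0 \<Rightarrow> q | A1 \<Rightarrow> 0 | B0 i \<Rightarrow> \<alpha> i - 1 | B1 i \<Rightarrow> \<alpha> i - 1 | B2 i \<Rightarrow> 0)"

definition scale_point :: "('v \<Rightarrow> nat) \<Rightarrow> nat \<Rightarrow> ('v \<Rightarrow> complex) \<Rightarrow> 'v \<Rightarrow> complex" where
  "scale_point w k c v = of_nat k ^ w v * c v"

lemma power_quotient_limit:
  assumes "a \<le> b"
  shows "(\<lambda>k. (of_nat k :: complex) ^ a / of_nat k ^ b) \<longlonglongrightarrow> (if a = b then 1 else 0)"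
proof (rule Lim_transform_eventually)
  show "(\<lambda>k. (1 / (of_nat k :: complex)) ^ (b - a)) \<longlonglongrightarrow> (if a = b then 1 else 0)"
  proof (cases "a = b")
    case False
    then have "(\<lambda>k. (1 / (of_nat k :: complex)) ^ (b - a)) \<longlonglongrightarrow> 0 ^ (b - a)"
      by (intro tendsto_power lim_1_over_n)
    with False assms show ?thesis by (simp add: zero_power)
  qed simp
  show "eventually (\<lambda>k. (1 / (of_nat k :: complex)) ^ (b - a) = of_nat k ^ a / of_nat k ^ b) sequentially"
    using eventually_gt_at_top[of 0]
    by eventually_elim (use assms in \<open>simp add: power_one_over power_diff field_simps\<close>)
qed

text \<open>After scaling, the factor of a tuple \<open>s\<close> is \<open>c A0\<close> times
  \<open>k ^ q\<close> plus \<open>c A1\<close> times \<open>k\<close> to the number of large roots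
  times a convergent product. Dividing by the larger power keeps the first term, the second, or
  both.\<close>

lemma pencil_det_scale_limit:
  fixes \<alpha> :: "'i::finite \<Rightarrow> nat"
  assumes \<alpha>: "\<And>i. 2 \<le> \<alpha> i" and c: "\<And>v. c v \<noteq> 0"
  obtains r :: "'i \<Rightarrow> nat \<Rightarrow> complex"
  where "\<And>i. bij_betw (r i) {1..<\<alpha> i} {w. w ^ (\<alpha> i - 1) = - c (B1 i) / c (B2 i)}"
    and "\<And>i. r i 0 = - c (B0 i) / c (B1 i)"
    and "(\<lambda>k. pencil_det \<alpha> (scale_point (quiver_weight \<alpha> q) k c) / of_nat k ^ (\<Sum>s\<in>idx \<alpha>. max q (card {i. s i \<noteq> 0})))
      \<longlonglongrightarrow> (\<Prod>i\<in>UNIV. c (B2 i) ^ (\<Prod>k\<in>UNIV - {i}. \<alpha> k)) *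
        (\<Prod>s\<in>idx \<alpha>. (if card {i. s i \<noteq> 0} \<le> q then c A0 else 0) +
          (if q \<le> card {i. s i \<noteq> 0} then c A1 * (\<Prod>i\<in>UNIV. r i (s i)) else 0))"
proof -
  define Q where "Q i y r \<longleftrightarrow> bij_betw r {1..<\<alpha> i} {w. w ^ (\<alpha> i - 1) = - c (B1 i) / c (B2 i)} \<and>
     (\<forall>k j. 0 < k \<longrightarrow> j < \<alpha> i \<longrightarrow> c (B0 i) / of_nat k + c (B1 i) * y k j + c (B2 i) * y k j ^ \<alpha> i = 0) \<and>
     (\<forall>j. 0 < j \<longrightarrow> j < \<alpha> i \<longrightarrow> (\<lambda>k. y k j) \<longlonglongrightarrow> r j) \<and>
     (\<lambda>k. of_nat k * y k 0) \<longlonglongrightarrow> - c (B0 i) / c (B1 i) \<and>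
     eventually (\<lambda>k. inj_on (y k) {..<\<alpha> i}) sequentially" for i y r
  have "\<exists>y r. Q i y r" for i
    unfolding Q_def
    by (rule trinomial_root_asymptotics[OF \<alpha>[of i] c[of "B0 i"] c[of "B1 i"] c[of "B2 i"]]) blast
  then obtain y r where Q: "\<And>i. Q i (y i) (r i)" by metis
  have r: "\<And>i. bij_betw (r i) {1..<\<alpha> i} {w. w ^ (\<alpha> i - 1) = - c (B1 i) / c (B2 i)}"
    and y: "\<And>i k j. 0 < k \<Longrightarrow> j < \<alpha> i \<Longrightarrow> c (B0 i) / of_nat k + c (B1 i) * y i k j + c (B2 i) * y i k j ^ \<alpha> i = 0"
    and lim: "\<And>i j. 0 < j \<Longrightarrow> j < \<alpha> i \<Longrightarrow> (\<lambda>k. y i k j) \<longlonglongrightarrow> r i j"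
    and lim0: "\<And>i. (\<lambda>k. of_nat k * y i k 0) \<longlonglongrightarrow> - c (B0 i) / c (B1 i)"
    and inj: "\<And>i. eventually (\<lambda>k. inj_on (y i k) {..<\<alpha> i}) sequentially"
    using Q by (simp_all add: Q_def)
  \<comment> \<open>At index 0 the root \<open>of_nat k * y i k 0\<close> itself converges, so its
    limit is recorded instead of that of \<open>y i k 0\<close>; \<open>x\<close> is normalized in
    the same way.\<close>
  define r' where "r' i j = (if j = 0 then - c (B0 i) / c (B1 i) else r i j)" for i j
  define x where "x i k j = (if j = 0 then of_nat k * y i k j else y i k j)" for i k j
  have limx: "(\<lambda>k. x i k j) \<longlonglongrightarrow> r' i j" if "j < \<alpha> i" for i j
    using lim lim0 that by (cases "j = 0") (auto simp: x_def r'_def)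
  define K where "K s = card {i. s i \<noteq> 0}" for s :: "'i \<Rightarrow> nat"
  let ?B = "\<Prod>i\<in>UNIV. c (B2 i) ^ (\<Prod>k\<in>UNIV - {i}. \<alpha> k)"
  let ?L = "\<lambda>s. (if K s \<le> q then c A0 else 0) + (if q \<le> K s then c A1 * (\<Prod>i\<in>UNIV. r' i (s i)) else 0)"
  let ?f = "\<lambda>s k. c A0 * (of_nat k ^ q / of_nat k ^ max q (K s)) +
      c A1 * (\<Prod>i\<in>UNIV. x i k (s i)) * (of_nat k ^ K s / of_nat k ^ max q (K s))"
  have "(\<lambda>k. ?B * (\<Prod>s\<in>idx \<alpha>. ?f s k)) \<longlonglongrightarrow> ?B * (\<Prod>s\<in>idx \<alpha>. ?L s)"
  proof (intro tendsto_mult tendsto_const tendsto_prod)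
    fix s assume s: "s \<in> idx \<alpha>"
    have "(\<lambda>k. ?f s k) \<longlonglongrightarrow> c A0 * (if q = max q (K s) then 1 else 0) +
        c A1 * (\<Prod>i\<in>UNIV. r' i (s i)) * (if K s = max q (K s) then 1 else 0)"
      using s by (intro tendsto_intros power_quotient_limit limx) (auto simp: idx_iff)
    moreover have "c A0 * (if q = max q (K s) then 1 else 0) +
        c A1 * (\<Prod>i\<in>UNIV. r' i (s i)) * (if K s = max q (K s) then 1 else 0) = ?L s" by auto
    ultimately show "(\<lambda>k. ?f s k) \<longlonglongrightarrow> ?L s" by simp
  qed
  moreover have "eventually (\<lambda>k. ?B * (\<Prod>s\<in>idx \<alpha>. ?f s k) =
      pencil_det \<alpha> (scale_point (quiver_weight \<alpha> q) k c) / of_nat k ^ (\<Sum>s\<in>idx \<alpha>. max q (K s))) sequentially"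
  proof -
    have "eventually (\<lambda>k. \<forall>i\<in>UNIV. inj_on (y i k) {..<\<alpha> i}) sequentially"
      by (intro eventually_ball_finite ballI inj) auto
    with eventually_gt_at_top[of 0] show ?thesis
    proof eventually_elim
      case (elim k)
      let ?h = "scale_point (quiver_weight \<alpha> q) k c"
      \<comment> \<open>By the choice of weights, the scaled trinomial at
        \<open>of_nat k * y i k j\<close> is \<open>of_nat k ^ \<alpha> i\<close> times the equation
        already solved by \<open>y i k j\<close>.\<close>
      have "pencil_det \<alpha> ?h = (\<Prod>i\<in>UNIV. ?h (B2 i) ^ (\<Prod>k\<in>UNIV - {i}. \<alpha> k)) *
         (\<Prod>s\<in>idx \<alpha>. ?h A0 + ?h A1 * (\<Prod>i\<in>UNIV. of_nat k * y i k (s i)))"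
      proof (rule pencil_det_eq_prod_roots[OF \<alpha>])
        fix i show "inj_on (\<lambda>j. of_nat k * y i k j) {..<\<alpha> i}"
          using elim by (auto simp: inj_on_def)
      next
        fix i j assume j: "j < \<alpha> i"
        obtain m where m: "\<alpha> i = Suc m" using j by (cases "\<alpha> i") auto
        have "?h (B0 i) + ?h (B1 i) * (of_nat k * y i k j) + ?h (B2 i) * (of_nat k * y i k j) ^ \<alpha> i =
            of_nat k ^ \<alpha> i * (c (B0 i) / of_nat k + c (B1 i) * y i k j + c (B2 i) * y i k j ^ \<alpha> i)"
          using elim by (simp add: scale_point_def quiver_weight_def m field_simps power_mult_distrib)
        then show "?h (B0 i) + ?h (B1 i) * (of_nat k * y i k j) + ?h (B2 i) * (of_nat k * y i k j) ^ \<alpha> i = 0"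
          using y elim j by simp
      qed
      moreover have "?h A0 + ?h A1 * (\<Prod>i\<in>UNIV. of_nat k * y i k (s i)) = of_nat k ^ max q (K s) * ?f s k" for s
      proof -
        have "of_nat k * y i k (s i) = (if s i \<noteq> 0 then of_nat k else 1) * x i k (s i)" for i
          by (simp add: x_def)
        then have "(\<Prod>i\<in>UNIV. of_nat k * y i k (s i)) = (\<Prod>i\<in>UNIV. if s i \<noteq> 0 then of_nat k else 1) * (\<Prod>i\<in>UNIV. x i k (s i))"
          by (simp add: prod.distrib)
        also have "(\<Prod>i\<in>UNIV. if s i \<noteq> 0 then of_nat k else 1) = (of_nat k :: complex) ^ K s"
          by (subst prod.If_cases) (auto simp: K_def Int_def)
        finally show ?thesis
          using elim by (simp add: scale_point_def quiver_weight_def distrib_left mult_ac)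
      qed
      ultimately show ?case
        using elim by (simp add: prod.distrib power_sum scale_point_def quiver_weight_def)
    qed
  qed
  ultimately have main: "(\<lambda>k. pencil_det \<alpha> (scale_point (quiver_weight \<alpha> q) k c) / of_nat k ^ (\<Sum>s\<in>idx \<alpha>. max q (K s)))
      \<longlonglongrightarrow> ?B * (\<Prod>s\<in>idx \<alpha>. ?L s)"
    by (rule Lim_transform_eventually)
  show thesis
  proof (rule that)
    show "bij_betw (r' i) {1..<\<alpha> i} {w. w ^ (\<alpha> i - 1) = - c (B1 i) / c (B2 i)}" for i
      using r[of i] by (rule iffD1[OF bij_betw_cong, rotated]) (auto simp: r'_def)
    show "r' i 0 = - c (B0 i) / c (B1 i)" for i by (simp add: r'_def)
  qed (rule main[unfolded K_def])
qed

section \<open>Initial forms by limits\<close>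

lemma monom_eval_scale_point:
  "monom_eval (scale_point w k c) u = of_nat k ^ (\<Sum>v\<in>Poly_Mapping.keys u. w v * Poly_Mapping.lookup u v) * monom_eval c u"
  by (simp add: monom_eval_def scale_point_def power_mult_distrib prod.distrib power_sum power_mult)

text \<open>Scaling multiplies a monomial by \<open>k\<close> to its weight. With \<open>W\<close>
  the maximal weight, all other monomials tend to 0 after division by \<open>k ^ W\<close>.\<close>

lemma initial_form_limit:
  fixes P :: "'v mpoly"
  assumes "P \<noteq> 0"
  obtains W where "initial_form (\<lambda>v. int (w v)) P \<noteq> 0"
    "\<And>c. (\<lambda>k. mev (scale_point w k c) P / of_nat k ^ W) \<longlonglongrightarrow> mev c (initial_form (\<lambda>v. int (w v)) P)"
proof -
  define wt where "wt u = (\<Sum>v\<in>Poly_Mapping.keys u. w v * Poly_Mapping.lookup u v)" for u :: "'v \<Rightarrow>\<^sub>0 nat"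
  have weight: "weight (\<lambda>v. int (w v)) u = int (wt u)" for u
    by (simp add: weight_def wt_def)
  define W where "W = Max (wt ` Poly_Mapping.keys P)"
  have ne: "Poly_Mapping.keys P \<noteq> {}" using assms by simp
  have le: "wt u \<le> W" if "u \<in> Poly_Mapping.keys P" for u
    using that by (simp add: W_def)
  have max: "u \<in> Poly_Mapping.keys P \<and> (\<forall>w'\<in>Poly_Mapping.keys P. weight (\<lambda>v. int (w v)) w' \<le> weight (\<lambda>v. int (w v)) u)
      \<longleftrightarrow> u \<in> Poly_Mapping.keys P \<and> wt u = W" for u
  proof -
    have "W \<in> wt ` Poly_Mapping.keys P" unfolding W_def using ne by (intro Max_in) auto
    then show ?thesis using le by (auto simp: weight le_antisym)
  qed
  have init: "initial_form (\<lambda>v. int (w v)) P =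
      (\<Sum>u | u \<in> Poly_Mapping.keys P \<and> wt u = W. Poly_Mapping.single u (Poly_Mapping.lookup P u))"
    unfolding initial_form_def max ..
  show thesis
  proof (rule that)
    have "W \<in> wt ` Poly_Mapping.keys P" unfolding W_def using ne by (intro Max_in) auto
    then obtain u where u: "u \<in> Poly_Mapping.keys P" "wt u = W" by blast
    have "Poly_Mapping.lookup (initial_form (\<lambda>v. int (w v)) P) u = Poly_Mapping.lookup P u"
      using u unfolding init lookup_sum by (simp add: lookup_single when_def)
    then show "initial_form (\<lambda>v. int (w v)) P \<noteq> 0"
      using u by (auto simp: in_keys_iff)
  next
    fix c :: "'v \<Rightarrow> complex"
    have "(\<lambda>k. \<Sum>u\<in>Poly_Mapping.keys P. of_int (Poly_Mapping.lookup P u) * monom_eval c u * (of_nat k ^ wt u / of_nat k ^ W))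
        \<longlonglongrightarrow> (\<Sum>u\<in>Poly_Mapping.keys P. of_int (Poly_Mapping.lookup P u) * monom_eval c u * (if wt u = W then 1 else 0))"
      by (intro tendsto_intros power_quotient_limit le)
    moreover have "(\<Sum>u\<in>Poly_Mapping.keys P. of_int (Poly_Mapping.lookup P u) * monom_eval c u * (if wt u = W then 1 else 0)) =
        mev c (initial_form (\<lambda>v. int (w v)) P)"
      unfolding init mev_sum mev_single
      by (intro sum.mono_neutral_cong_right) auto
    moreover have "mev (scale_point w k c) P / of_nat k ^ W =
       (\<Sum>u\<in>Poly_Mapping.keys P. of_int (Poly_Mapping.lookup P u) * monom_eval c u * (of_nat k ^ wt u / of_nat k ^ W))" for k
      by (simp add: mev_def monom_eval_scale_point wt_def sum_divide_distrib mult_ac)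
    ultimately show "(\<lambda>k. mev (scale_point w k c) P / of_nat k ^ W) \<longlonglongrightarrow> mev c (initial_form (\<lambda>v. int (w v)) P)"
      by simp
  qed
qed

text \<open>If division by one power of \<open>k\<close> gives a finite limit, a larger power gives
  the limit 0. Both limits are nonzero at some common point, so the exponents \<open>D\<close> and
  \<open>W\<close> agree, and then the limits agree at all points without zero coordinates.\<close>

lemma initial_form_eqI:
  fixes P Q :: "'v mpoly"
  assumes nz: "P \<noteq> 0" "Q \<noteq> 0"
    and lim: "\<And>c. (\<And>v. c v \<noteq> 0) \<Longrightarrow> (\<lambda>k. mev (scale_point w k c) P / of_nat k ^ D) \<longlonglongrightarrow> mev c Q"
    and fin: "finite (UNIV :: 'v set)"
  shows "initial_form (\<lambda>v. int (w v)) P = Q"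
proof -
  obtain W where W: "initial_form (\<lambda>v. int (w v)) P \<noteq> 0"
    "\<And>c. (\<lambda>k. mev (scale_point w k c) P / of_nat k ^ W) \<longlonglongrightarrow> mev c (initial_form (\<lambda>v. int (w v)) P)"
    using initial_form_limit[OF nz(1)] by blast
  let ?I = "initial_form (\<lambda>v. int (w v)) P"
  obtain vs :: "'v list" where vs: "set vs = UNIV" using finite_list[OF fin] by blast
  have gnz: "generic vs (\<lambda>c. \<forall>v. c v \<noteq> 0) c" for c :: "'v \<Rightarrow> complex"
    using generic_nonzero[OF fin, of vs] vs by simp
  have "generic vs (\<lambda>c. mev c ?I \<noteq> 0 \<and> mev c Q \<noteq> 0) (\<lambda>_. 0)"
    using nz W(1) vs by (intro generic_conj generic_mev_nonzero) auto
  from generic_conj[OF gnz this] obtain c :: "'v \<Rightarrow> complex"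
    where c: "\<And>v. c v \<noteq> 0" "mev c ?I \<noteq> 0" "mev c Q \<noteq> 0"
    by (rule generic_ex) blast
  have quot: "f k / of_nat k ^ b = (f k / of_nat k ^ a) * (of_nat k ^ a / of_nat k ^ b)" if "k > 0"
    for f :: "nat \<Rightarrow> complex" and k a b
    using that by simp
  have zero: "L' = 0" if "(\<lambda>k. f k / of_nat k ^ a) \<longlonglongrightarrow> L" "(\<lambda>k. f k / of_nat k ^ b) \<longlonglongrightarrow> L'" "a < b"
    for f :: "nat \<Rightarrow> complex" and L L' a b
  proof -
    have "(\<lambda>k. (f k / of_nat k ^ a) * (of_nat k ^ a / of_nat k ^ b)) \<longlonglongrightarrow> L * (if a = b then 1 else 0)"
      using that by (intro tendsto_mult power_quotient_limit) auto
    then have "(\<lambda>k. f k / of_nat k ^ b) \<longlonglongrightarrow> L * (if a = b then 1 else 0)"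
      by (rule Lim_transform_eventually)
         (use eventually_gt_at_top[of 0] in eventually_elim, rule quot[symmetric])
    with that show ?thesis using LIMSEQ_unique by force
  qed
  have "W = D"
    using zero[OF W(2)[of c] lim[OF c(1)]] zero[OF lim[OF c(1)] W(2)[of c]] c by force
  have "mev c ?I = mev c Q" if "\<forall>v. c v \<noteq> 0" for c :: "'v \<Rightarrow> complex"
    using W(2)[of c] lim[of c] that \<open>W = D\<close> LIMSEQ_unique by blast
  then show ?thesis
    by (rule mev_generic_eqI[OF gnz vs])
qed

section \<open>Products over tuples of roots\<close>

text \<open>This is the factorization of \<open>x ^ m - w\<close> into linear factors at
  \<open>x = A / B\<close>, multiplied by \<open>B ^ m\<close>; the case \<open>B = 0\<close> is
  separate.\<close>

lemma prod_diff_nth_roots: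
  fixes w :: complex
  assumes m: "0 < m" and w: "w \<noteq> 0"
  shows "(\<Prod>r | r ^ m = w. A - B * r) = A ^ m - B ^ m * w"
proof (cases "B = 0")
  case True
  then show ?thesis using m w by (simp add: card_nth_roots zero_power)
next
  case False
  define p where "p = monom 1 m - [:w:]"
  have pv: "poly p x = x ^ m - w" for x by (simp add: p_def poly_monom)
  have roots: "{x. poly p x = 0} = {r. r ^ m = w}" by (auto simp: pv)
  have "pderiv p = monom (of_nat m) (m - 1)"
    by (simp add: p_def pderiv_diff pderiv_monom pderiv_pCons)
  then have "rsquarefree p"
    unfolding rsquarefree_roots using m w by (auto simp: pv poly_monom zero_power)
  moreover have "lead_coeff p = 1"
  proof -
    have "p = [:- w:] + monom 1 m" by (simp add: p_def)
    moreover have "degree [:- w:] < degree (monom (1::complex) m)"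
      using m by (simp add: degree_monom_eq)
    ultimately show ?thesis by (simp only: lead_coeff_add_le) (simp add: degree_monom_eq)
  qed
  ultimately have "(\<Prod>r | r ^ m = w. [:- r, 1:]) = p"
    using complex_poly_decompose_rsquarefree[of p] by (simp add: roots)
  then have "poly (\<Prod>r | r ^ m = w. [:- r, 1:]) (A / B) = (A / B) ^ m - w"
    by (simp add: pv)
  then have "(\<Prod>r | r ^ m = w. A / B - r) = (A / B) ^ m - w"
    by (simp add: poly_prod)
  then have "B ^ m * (\<Prod>r | r ^ m = w. A / B - r) = B ^ m * ((A / B) ^ m - w)"
    by simp
  moreover have "B ^ m * (\<Prod>r | r ^ m = w. A / B - r) = (\<Prod>r | r ^ m = w. B * (A / B - r))"
    using m w by (simp add: prod.distrib card_nth_roots)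
  ultimately show ?thesis
    using False by (simp add: right_diff_distrib power_divide)
qed

lemma power_gcd_eq_1:
  fixes x :: "'a::field"
  assumes "x ^ m = 1" "x ^ l = 1" "0 < m"
  shows "x ^ gcd m l = 1"
proof -
  obtain a b where ab: "m * a = l * b + gcd m l"
    using bezout_nat[of m l] assms(3) by auto
  have "x ^ (m * a) = 1" "x ^ (l * b) = 1"
    using assms by (simp_all add: power_mult)
  then show ?thesis by (simp add: ab power_add)
qed

text \<open>
  The map \<open>r \<mapsto> r ^ l\<close> sends the \<open>m\<close>-th roots of \<open>w\<close> to the \<open>m / gcd m l\<close>-th roots of
  \<open>w ^ (l / gcd m l)\<close>. Its fibres have at most \<open>gcd m l\<close> elements, hence exactly that many by
  counting.
\<close>

lemma prod_diff_nth_roots_power: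
  fixes w :: complex
  assumes m: "0 < m" and w: "w \<noteq> 0"
  shows "(\<Prod>r | r ^ m = w. A - B * r ^ l) =
    (A ^ (m div gcd m l) - B ^ (m div gcd m l) * w ^ (l div gcd m l)) ^ gcd m l"
proof -
  define d where "d = gcd m l"
  define m' where "m' = m div d"
  define l' where "l' = l div d"
  have d: "0 < d" "m = m' * d" "l = l' * d"
    using m by (auto simp: d_def m'_def l'_def)
  then have m': "0 < m'" using m by (cases m') auto
  define U where "U = {u :: complex. u ^ m' = w ^ l'}"
  define R where "R = {r :: complex. r ^ m = w}"
  define fib where "fib u = {r \<in> R. r ^ l = u}" for u
  have finU: "finite U" and cU: "card U = m'"
    unfolding U_def using m' w by (auto intro!: finite_nth_roots card_nth_roots)
  have finR: "finite R" and cR: "card R = m"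
    unfolding R_def using m w by (auto intro!: finite_nth_roots card_nth_roots)
  have maps: "r ^ l \<in> U" if "r \<in> R" for r
  proof -
    have "(r ^ l) ^ m' = (r ^ m) ^ l'"
      by (simp add: d power_mult[symmetric] mult_ac)
    then show ?thesis using that by (simp add: R_def U_def)
  qed
  have R: "R = (\<Union>u\<in>U. fib u)" using maps by (auto simp: fib_def)
  have le: "card (fib u) \<le> d" for u
  proof (cases "fib u = {}")
    case False
    then obtain r0 where r0: "r0 \<in> fib u" by blast
    have r0nz: "r0 \<noteq> 0" using r0 w m by (auto simp: fib_def R_def zero_power)
    \<comment> \<open>Dividing by a fixed element embeds the fibre into the \<open>d\<close>-th
      roots of unity.\<close>
    have "(\<lambda>r. r / r0) ` fib u \<subseteq> {x. x ^ d = 1}"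
    proof clarify
      fix r assume r: "r \<in> fib u"
      have "(r / r0) ^ m = 1"
        using r r0 w by (auto simp: fib_def R_def power_divide)
      moreover have "(r / r0) ^ l = 1"
        using r r0 r0nz by (auto simp: fib_def power_divide)
      ultimately show "(r / r0) ^ d = 1"
        unfolding d_def using m by (rule power_gcd_eq_1)
    qed
    moreover have "inj_on (\<lambda>r. r / r0) (fib u)" using r0nz by (auto simp: inj_on_def)
    ultimately have "card (fib u) \<le> card {x :: complex. x ^ d = 1}"
      using d by (intro card_inj_on_le finite_nth_roots)
    then show ?thesis using d by (simp add: card_nth_roots)
  qed auto
  have sum: "(\<Sum>u\<in>U. card (fib u)) = (\<Sum>u\<in>U. d)"
  proof -
    have "(\<Sum>u\<in>U. card (fib u)) = card R"
      unfolding R by (rule card_UN_disjoint[symmetric]) (use finU finR in \<open>auto simp: fib_def\<close>)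
    then show ?thesis by (simp add: cR cU d)
  qed
  have card_fib: "card (fib u) = d" if "u \<in> U" for u
  proof (rule ccontr)
    assume "card (fib u) \<noteq> d"
    then have "card (fib u) < d" using le[of u] by simp
    then have "(\<Sum>u\<in>U. card (fib u)) < (\<Sum>u\<in>U. d)"
      using that finU le by (intro sum_strict_mono_ex1) auto
    with sum show False by simp
  qed
  have "(\<Prod>r\<in>R. A - B * r ^ l) = (\<Prod>u\<in>U. \<Prod>r\<in>fib u. A - B * r ^ l)"
    unfolding R by (rule prod.UNION_disjoint) (use finU finR in \<open>auto simp: fib_def\<close>)
  also have "\<dots> = (\<Prod>u\<in>U. (A - B * u) ^ d)"
  proof (rule prod.cong[OF refl])
    fix u assume "u \<in> U"
    have "(\<Prod>r\<in>fib u. A - B * r ^ l) = (\<Prod>r\<in>fib u. A - B * u)"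
      by (rule prod.cong) (auto simp: fib_def)
    then show "(\<Prod>r\<in>fib u. A - B * r ^ l) = (A - B * u) ^ d"
      using \<open>u \<in> U\<close> by (simp add: card_fib)
  qed
  also have "\<dots> = (\<Prod>u\<in>U. A - B * u) ^ d"
    by (rule prod_power_distrib[symmetric])
  also have "(\<Prod>u\<in>U. A - B * u) = A ^ m' - B ^ m' * w ^ l'"
    unfolding U_def using m' w by (intro prod_diff_nth_roots) auto
  finally show ?thesis by (simp add: R_def m'_def l'_def d_def)
qed

section \<open>Products over tuples with one root from each set\<close>

lemma prod_PiE_insert:
  fixes f :: "('a \<Rightarrow> 'b) \<Rightarrow> 'c::comm_monoid_mult"
  assumes "k \<notin> K"
  shows "(\<Prod>s\<in>PiE (insert k K) S. f s) = (\<Prod>y\<in>S k. \<Prod>g\<in>PiE K S. f (g(k := y)))"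
  unfolding prod.cartesian_product using assms
  by (intro prod.reindex_bij_witness[of _ "\<lambda>(y, g). g(k := y)" "\<lambda>g. (g k, g(k := undefined))"])
     (auto simp: PiE_def extensional_def)

text \<open>This turns out to be \<open>prod_pred \<alpha> K\<close> divided by the gcd of the
  exponents of the binomial, that is, the exponent of \<open>A0\<close> after reduction.\<close>

definition lcm_pred :: "('i \<Rightarrow> nat) \<Rightarrow> 'i set \<Rightarrow> nat" where
  "lcm_pred \<alpha> K = Lcm ((\<lambda>k. \<alpha> k - 1) ` K)"

lemma lcm_pred_dvd: "k \<in> K \<Longrightarrow> \<alpha> k - 1 dvd lcm_pred \<alpha> K"
  by (auto simp: lcm_pred_def)

lemma lcm_pred_dvd_prod_pred: "finite K \<Longrightarrow> lcm_pred \<alpha> K dvd prod_pred \<alpha> K"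
  by (auto simp: lcm_pred_def prod_pred_def intro!: Lcm_least)

lemma prod_pred_pos: "finite K \<Longrightarrow> (\<And>k. k \<in> K \<Longrightarrow> 2 \<le> \<alpha> k) \<Longrightarrow> 0 < prod_pred \<alpha> K"
  unfolding prod_pred_def by (rule prod_pos) force

lemma lcm_pred_pos: "finite K \<Longrightarrow> (\<And>k. k \<in> K \<Longrightarrow> 2 \<le> \<alpha> k) \<Longrightarrow> 0 < lcm_pred \<alpha> K"
  using lcm_pred_dvd_prod_pred[of K \<alpha>] prod_pred_pos[of K \<alpha>] by (metis dvd_pos_nat)

lemma prod_pred_remove: "finite K \<Longrightarrow> k \<in> K \<Longrightarrow> prod_pred \<alpha> K = (\<alpha> k - 1) * prod_pred \<alpha> (K - {k})"
  unfolding prod_pred_def by (rule prod.remove)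

text \<open>Induction on \<open>K\<close> for all \<open>B\<close>: for a fixed root at the new
  index the induction hypothesis is applied to \<open>B\<close> times this root, and the product
  over these roots is given by \<open>prod_diff_nth_roots_power\<close>. Its exponent
  \<open>m div gcd m L\<close> turns \<open>L\<close> into the lcm of \<open>m\<close> and
  \<open>L\<close>.\<close>

lemma prod_root_tuples:
  fixes w :: "'i \<Rightarrow> complex"
  assumes "finite K" and "\<And>k. k \<in> K \<Longrightarrow> 2 \<le> \<alpha> k" and "\<And>k. k \<in> K \<Longrightarrow> w k \<noteq> 0"
    and "\<And>k. k \<in> K \<Longrightarrow> bij_betw (r k) {1..<\<alpha> k} {x. x ^ (\<alpha> k - 1) = w k}"
  shows "(\<Prod>s\<in>PiE K (\<lambda>k. {1..<\<alpha> k}). A - B * (\<Prod>k\<in>K. r k (s k))) =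
    (A ^ lcm_pred \<alpha> K - B ^ lcm_pred \<alpha> K * (\<Prod>k\<in>K. w k ^ (lcm_pred \<alpha> K div (\<alpha> k - 1)))) ^
      (prod_pred \<alpha> K div lcm_pred \<alpha> K)"
  using assms
proof (induction K arbitrary: B rule: finite_induct)
  case empty
  then show ?case by (simp add: lcm_pred_def prod_pred_def)
next
  case (insert k K)
  define L where "L = lcm_pred \<alpha> K"
  define N where "N = prod_pred \<alpha> K"
  define W where "W = (\<Prod>k\<in>K. w k ^ (L div (\<alpha> k - 1)))"
  define m where "m = \<alpha> k - 1"
  define d where "d = gcd m L"
  have m: "0 < m" using insert.prems(1)[of k] by (simp add: m_def)
  have L: "0 < L" unfolding L_def using insert.hyps insert.prems by (intro lcm_pred_pos) auto
  have LN: "L dvd N" unfolding L_def N_def using insert.hyps by (intro lcm_pred_dvd_prod_pred)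
  have L': "lcm_pred \<alpha> (insert k K) = L * (m div d)"
    by (simp add: lcm_pred_def L_def m_def d_def lcm_nat_def mult.commute div_mult_swap)
  have N': "prod_pred \<alpha> (insert k K) = m * N"
    using insert.hyps by (simp add: prod_pred_def m_def N_def)
  have "(\<Prod>s\<in>PiE (insert k K) (\<lambda>k. {1..<\<alpha> k}). A - B * (\<Prod>k\<in>insert k K. r k (s k))) =
     (\<Prod>y\<in>{1..<\<alpha> k}. \<Prod>g\<in>PiE K (\<lambda>k. {1..<\<alpha> k}). A - B * r k y * (\<Prod>k\<in>K. r k (g k)))"
    unfolding prod_PiE_insert[OF insert.hyps(2)]
  proof (intro prod.cong refl)
    fix y g
    have "(\<Prod>j\<in>K. r j ((g(k := y)) j)) = (\<Prod>j\<in>K. r j (g j))"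
      using insert.hyps by (intro prod.cong) auto
    then show "A - B * (\<Prod>j\<in>insert k K. r j ((g(k := y)) j)) = A - B * r k y * (\<Prod>k\<in>K. r k (g k))"
      using insert.hyps by (simp add: mult.assoc)
  qed
  also have "\<dots> = (\<Prod>y\<in>{1..<\<alpha> k}. (A ^ L - (B * r k y) ^ L * W) ^ (N div L))"
    unfolding L_def N_def W_def using insert.prems
    by (intro prod.cong refl insert.IH) auto
  also have "\<dots> = (\<Prod>y\<in>{1..<\<alpha> k}. A ^ L - B ^ L * W * r k y ^ L) ^ (N div L)"
    by (simp add: prod_power_distrib power_mult_distrib mult_ac)
  also have "(\<Prod>y\<in>{1..<\<alpha> k}. A ^ L - B ^ L * W * r k y ^ L) = (\<Prod>x | x ^ m = w k. A ^ L - B ^ L * W * x ^ L)"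
    unfolding m_def using insert.prems(3)[of k] by (intro prod.reindex_bij_betw) auto
  also have "\<dots> = ((A ^ L) ^ (m div d) - (B ^ L * W) ^ (m div d) * w k ^ (L div d)) ^ d"
    unfolding d_def using m insert.prems(2)[of k] by (intro prod_diff_nth_roots_power) auto
  also have "(A ^ L) ^ (m div d) = A ^ lcm_pred \<alpha> (insert k K)"
    by (simp add: L' power_mult)
  also have "(B ^ L * W) ^ (m div d) * w k ^ (L div d) =
     B ^ lcm_pred \<alpha> (insert k K) * (\<Prod>j\<in>insert k K. w j ^ (lcm_pred \<alpha> (insert k K) div (\<alpha> j - 1)))"
  proof -
    have "W ^ (m div d) = (\<Prod>j\<in>K. w j ^ (lcm_pred \<alpha> (insert k K) div (\<alpha> j - 1)))"
      unfolding W_def prod_power_distrib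
    proof (intro prod.cong refl)
      fix j assume "j \<in> K"
      then have "\<alpha> j - 1 dvd L" unfolding L_def by (rule lcm_pred_dvd)
      then show "(w j ^ (L div (\<alpha> j - 1))) ^ (m div d) = w j ^ (lcm_pred \<alpha> (insert k K) div (\<alpha> j - 1))"
        by (simp add: L' power_mult[symmetric] dvd_div_mult)
    qed
    moreover have "L * (m div d) div m = L div d"
    proof -
      have "L * (m div d) = (L div d) * m"
        by (metis d_def div_mult_swap dvd_div_mult gcd_dvd1 gcd_dvd2)
      then show ?thesis using m by simp
    qed
    moreover have "\<alpha> k - Suc 0 = m" by (simp add: m_def)
    ultimately show ?thesis
      using insert.hyps by (simp add: power_mult_distrib L' power_mult mult_ac)
  qed
  also have "((A ^ lcm_pred \<alpha> (insert k K) - B ^ lcm_pred \<alpha> (insert k K) *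
      (\<Prod>j\<in>insert k K. w j ^ (lcm_pred \<alpha> (insert k K) div (\<alpha> j - 1)))) ^ d) ^ (N div L) =
      (A ^ lcm_pred \<alpha> (insert k K) - B ^ lcm_pred \<alpha> (insert k K) *
      (\<Prod>j\<in>insert k K. w j ^ (lcm_pred \<alpha> (insert k K) div (\<alpha> j - 1)))) ^ (prod_pred \<alpha> (insert k K) div lcm_pred \<alpha> (insert k K))"
  proof -
    have d: "0 < d" "d dvd m" using m by (auto simp: d_def)
    obtain m' where m': "m = d * m'" using d(2) by (auto elim: dvdE)
    obtain N1 where N1: "N = L * N1" using LN by (auto elim: dvdE)
    have "m * N div (L * (m div d)) = d * (N div L)"
      using d(1) L m by (simp add: m' N1)
    then show ?thesis by (simp add: power_mult[symmetric] L' N')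
  qed
  finally show ?case .
qed

section \<open>The binomials\<close>

lemma prod_coeff_UNIV:
  fixes f :: "'i::finite coeff \<Rightarrow> 'a::comm_monoid_mult"
  shows "(\<Prod>v\<in>UNIV. f v) = f A0 * f A1 * (\<Prod>i\<in>UNIV. f (B0 i) * f (B1 i) * f (B2 i))"
proof -
  have U: "(UNIV :: 'i coeff set) = {A0} \<union> ({A1} \<union> (range B0 \<union> (range B1 \<union> range B2)))"
  proof -
    have "v \<in> {A0} \<union> ({A1} \<union> (range B0 \<union> (range B1 \<union> range B2)))" for v :: "'i coeff"
      by (cases v) auto
    then show ?thesis by blast
  qed
  have "(\<Prod>v\<in>UNIV. f v) = f A0 * (f A1 * ((\<Prod>v\<in>range B0. f v) * ((\<Prod>v\<in>range B1. f v) * (\<Prod>v\<in>range B2. f v))))"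
    unfolding U by (subst prod.union_disjoint, simp, simp, fastforce)+ simp
  also have "(\<Prod>v\<in>range B0. f v) = (\<Prod>i\<in>UNIV. f (B0 i))" by (subst prod.reindex) (auto simp: inj_on_def)
  also have "(\<Prod>v\<in>range B1. f v) = (\<Prod>i\<in>UNIV. f (B1 i))" by (subst prod.reindex) (auto simp: inj_on_def)
  also have "(\<Prod>v\<in>range B2. f v) = (\<Prod>i\<in>UNIV. f (B2 i))" by (subst prod.reindex) (auto simp: inj_on_def)
  finally show ?thesis by (simp add: prod.distrib mult_ac)
qed

lemma finite_coeff: "finite (UNIV :: 'i::finite coeff set)"
proof -
  have "(UNIV :: 'i coeff set) \<subseteq> {A0, A1} \<union> range B0 \<union> range B1 \<union> range B2"
  proof
    fix v :: "'i coeff" show "v \<in> {A0, A1} \<union> range B0 \<union> range B1 \<union> range B2" by (cases v) auto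
  qed
  then show ?thesis by (rule finite_subset) auto
qed

lemma lookup_phi_first:
  fixes K :: "'i::finite set"
  shows "Poly_Mapping.lookup (phi_first \<alpha> I K) v = (case v of A0 \<Rightarrow> prod_pred \<alpha> K
     | B1 i \<Rightarrow> if i \<in> I then prod_pred \<alpha> K else 0 | B2 k \<Rightarrow> if k \<in> K then prod_pred \<alpha> (K - {k}) else 0 | _ \<Rightarrow> 0)"
  by (cases v) (auto simp: phi_first_def lookup_add lookup_sum lookup_single when_def)

lemma lookup_phi_second:
  fixes K :: "'i::finite set"
  assumes "I \<inter> K = {}"
  shows "Poly_Mapping.lookup (phi_second \<alpha> I K) v = (case v of A1 \<Rightarrow> prod_pred \<alpha> K
     | B0 i \<Rightarrow> if i \<in> I then prod_pred \<alpha> K else 0 | B1 k \<Rightarrow> if k \<in> K then prod_pred \<alpha> (K - {k}) else 0 | _ \<Rightarrow> 0)"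
  using assms by (cases v) (auto simp: phi_second_def lookup_add lookup_sum lookup_single when_def)

text \<open>The nonzero exponents are \<open>n = prod_pred \<alpha> K\<close> and the quotients of
  \<open>n\<close> by \<open>\<alpha> k - 1\<close>. If \<open>g\<close> divides them all, then
  every \<open>\<alpha> k - 1\<close>, and so their lcm, divides \<open>n div g\<close>; conversely
  \<open>n\<close> divided by the lcm divides all exponents.\<close>

lemma exponents_gcd_phi:
  fixes K :: "'i::finite set"
  assumes \<alpha>: "\<And>i. 2 \<le> \<alpha> i" and IK: "I \<inter> K = {}"
  shows "exponents_gcd (phi_first \<alpha> I K) (phi_second \<alpha> I K) = prod_pred \<alpha> K div lcm_pred \<alpha> K"
proof -
  define n where "n = prod_pred \<alpha> K"
  define L where "L = lcm_pred \<alpha> K"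
  define g where "g = exponents_gcd (phi_first \<alpha> I K) (phi_second \<alpha> I K)"
  have n: "0 < n" unfolding n_def using \<alpha> by (intro prod_pred_pos) auto
  have Ln: "L dvd n" unfolding L_def n_def by (intro lcm_pred_dvd_prod_pred) auto
  have L: "0 < L" using n Ln by (metis dvd_pos_nat)
  have rem: "n = (\<alpha> k - 1) * prod_pred \<alpha> (K - {k})" if "k \<in> K" for k
    unfolding n_def using that by (intro prod_pred_remove) auto
  have "n div L dvd g"
    unfolding g_def exponents_gcd_def
  proof (rule Gcd_greatest)
    have 1: "n div L dvd n" using Ln by (metis dvd_mult_div_cancel dvd_triv_right)
    have 2: "n div L dvd prod_pred \<alpha> (K - {k})" if k: "k \<in> K" for k
    proof -
      obtain l where l: "L = (\<alpha> k - 1) * l"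
        using lcm_pred_dvd[OF k, of \<alpha>] by (auto simp: L_def elim: dvdE)
      obtain n' where n': "n = L * n'" using Ln by (auto elim: dvdE)
      have "0 < \<alpha> k - 1" using \<alpha>[of k] by simp
      then have "prod_pred \<alpha> (K - {k}) = l * n'"
        using rem[OF k] n' l by (metis mult.assoc mult_cancel1 neq0_conv)
      then show ?thesis using n' L by simp
    qed
    fix x assume "x \<in> range (Poly_Mapping.lookup (phi_first \<alpha> I K)) \<union> range (Poly_Mapping.lookup (phi_second \<alpha> I K))"
    then show "n div L dvd x"
      using 1 2 by (auto simp: lookup_phi_first lookup_phi_second[OF IK] n_def split: coeff.splits)
  qed
  moreover have "g dvd n div L"
  proof -
    have gl: "g dvd Poly_Mapping.lookup (phi_first \<alpha> I K) v" for v
      unfolding g_def exponents_gcd_def by (rule Gcd_dvd) auto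
    have gn: "g dvd n" using gl[of A0] by (simp add: lookup_phi_first n_def)
    have "\<alpha> k - 1 dvd n div g" if k: "k \<in> K" for k
    proof -
      have "g dvd prod_pred \<alpha> (K - {k})" using gl[of "B2 k"] k by (simp add: lookup_phi_first)
      then show ?thesis using rem[OF k] by (metis div_mult_swap dvd_triv_left)
    qed
    then have "L dvd n div g" by (auto simp: L_def lcm_pred_def intro!: Lcm_least)
    then obtain x where "n div g = L * x" by (rule dvdE)
    then have "n = g * (L * x)" using gn by (metis dvd_mult_div_cancel)
    then show ?thesis using L by (simp add: mult.left_commute[of g])
  qed
  ultimately show ?thesis
    unfolding g_def n_def L_def by (rule dvd_antisym[rotated])
qed

lemma lookup_div_exponents: "Poly_Mapping.lookup (div_exponents u g) v = Poly_Mapping.lookup u v div g"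
  by (simp add: div_exponents_def map.rep_eq when_def)

lemma prod_if_power:
  fixes f :: "'i::finite \<Rightarrow> 'a::comm_ring_1"
  shows "(\<Prod>i\<in>UNIV. f i ^ (if P i then e i else 0)) = (\<Prod>i | P i. f i ^ e i)"
proof -
  have "(\<Prod>i\<in>UNIV. f i ^ (if P i then e i else 0)) = (\<Prod>i\<in>UNIV. if P i then f i ^ e i else 1)"
    by (intro prod.cong) auto
  then show ?thesis by (simp add: prod.If_cases)
qed

lemma monom_eval_coeff:
  fixes h :: "'i::finite coeff \<Rightarrow> 'a::comm_ring_1"
  shows "monom_eval h u = h A0 ^ Poly_Mapping.lookup u A0 * h A1 ^ Poly_Mapping.lookup u A1 *
    ((\<Prod>i\<in>UNIV. h (B0 i) ^ Poly_Mapping.lookup u (B0 i)) * (\<Prod>i\<in>UNIV. h (B1 i) ^ Poly_Mapping.lookup u (B1 i)) *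
     (\<Prod>i\<in>UNIV. h (B2 i) ^ Poly_Mapping.lookup u (B2 i)))"
  by (subst monom_eval_superset[OF finite_coeff]) (auto simp: prod_coeff_UNIV prod.distrib)

text \<open>Dividing by the gcd turns \<open>prod_pred \<alpha> K\<close> into \<open>L K\<close>
  and \<open>prod_pred \<alpha> (K - {k})\<close> into \<open>L K div (\<alpha> k - 1)\<close>,
  which is the form produced by \<open>prod_root_tuples\<close>.\<close>

lemma mev_GCD_phi:
  fixes c :: "'i::finite coeff \<Rightarrow> complex"
  assumes \<alpha>: "\<And>i. 2 \<le> \<alpha> i"
  defines "L \<equiv> \<lambda>K. lcm_pred \<alpha> K"
  shows "mev c (GCD_op (phi_binomial \<alpha> (- K) K)) =
    (c A0 ^ L K * (\<Prod>i\<in>- K. c (B1 i) ^ L K) * (\<Prod>k\<in>K. c (B2 k) ^ (L K div (\<alpha> k - 1))) +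
     (-1) ^ (1 + (card (- K) + 1) * L K + (\<Sum>k\<in>K. L K div (\<alpha> k - 1))) *
     (c A1 ^ L K * (\<Prod>i\<in>- K. c (B0 i) ^ L K) * (\<Prod>k\<in>K. c (B1 k) ^ (L K div (\<alpha> k - 1))))) ^
    (prod_pred \<alpha> K div L K)"
proof -
  define n where "n = prod_pred \<alpha> K"
  define g where "g = n div L K"
  have ex: "exponents_gcd (phi_first \<alpha> (- K) K) (phi_second \<alpha> (- K) K) = g"
    unfolding g_def n_def L_def using \<alpha> by (intro exponents_gcd_phi) auto
  have n: "0 < n" unfolding n_def using \<alpha> by (intro prod_pred_pos) auto
  have Ln: "L K dvd n" unfolding L_def n_def by (intro lcm_pred_dvd_prod_pred) auto
  then have n_eq: "n = L K * g" by (simp add: g_def)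
  then have g: "0 < g" using n by (cases g) auto
  have ng: "n div g = L K" using n_eq g by simp
  have ngk: "prod_pred \<alpha> (K - {k}) div g = L K div (\<alpha> k - 1)" if k: "k \<in> K" for k
  proof -
    obtain l where l: "L K = (\<alpha> k - 1) * l"
      using lcm_pred_dvd[OF k, of \<alpha>] by (auto simp: L_def elim: dvdE)
    have pos: "0 < \<alpha> k - 1" using \<alpha>[of k] by simp
    have "(\<alpha> k - 1) * prod_pred \<alpha> (K - {k}) = (\<alpha> k - 1) * (l * g)"
      using prod_pred_remove[of K k \<alpha>] k n_eq l by (auto simp: n_def)
    then have "prod_pred \<alpha> (K - {k}) = l * g" using pos by (metis mult_cancel1 neq0_conv)
    then show ?thesis using g pos l by simp
  qed
  have s: "phi_sign \<alpha> (- K) K = (-1) ^ (1 + (card (- K) + 1) * L K + (\<Sum>k\<in>K. L K div (\<alpha> k - 1)))"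
    by (simp add: phi_sign_def ex Let_def n_def[symmetric] ng ngk)
  have z: "(if b then x else 0) div g = (if b then x div g else 0)" for b x by simp
  have pK: "(\<Prod>k\<in>K. h k ^ (prod_pred \<alpha> (K - {k}) div g)) = (\<Prod>k\<in>K. h k ^ (L K div (\<alpha> k - 1)))"
    for h :: "'i \<Rightarrow> complex"
    by (intro prod.cong) (auto simp: ngk)
  have "monom_eval c (div_exponents (phi_first \<alpha> (- K) K) g) =
     c A0 ^ L K * (\<Prod>i\<in>- K. c (B1 i) ^ L K) * (\<Prod>k\<in>K. c (B2 k) ^ (L K div (\<alpha> k - 1)))"
    by (simp add: monom_eval_coeff lookup_div_exponents lookup_phi_first z prod_if_power n_def[symmetric] ng pK
        Compl_eq[symmetric])
  moreover have "monom_eval c (div_exponents (phi_second \<alpha> (- K) K) g) =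
     c A1 ^ L K * (\<Prod>i\<in>- K. c (B0 i) ^ L K) * (\<Prod>k\<in>K. c (B1 k) ^ (L K div (\<alpha> k - 1)))"
    by (simp add: monom_eval_coeff lookup_div_exponents lookup_phi_second z prod_if_power n_def[symmetric] ng pK
        Compl_eq[symmetric])
  ultimately show ?thesis
    by (simp add: phi_binomial_def ex Let_def mev.hom_power mev_add s g_def[symmetric] n_def[symmetric])
qed

section \<open>The limit is the announced initial form\<close>

text \<open>A tuple is its support \<open>K\<close> together with positive entries on it. Index 0
  stands for the small root, so \<open>K\<close> is the set of indices with a large root.\<close>

lemma prod_idx_by_support:
  fixes f :: "('i::finite \<Rightarrow> nat) \<Rightarrow> 'a::comm_monoid_mult"
  assumes "\<And>i. 0 < \<alpha> i"
  shows "(\<Prod>s\<in>idx \<alpha>. f s) =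
    (\<Prod>K\<in>UNIV. \<Prod>g\<in>PiE K (\<lambda>k. {1..<\<alpha> k}). f (\<lambda>i. if i \<in> K then g i else 0))"
proof -
  have "(\<Prod>K\<in>UNIV. \<Prod>g\<in>PiE K (\<lambda>k. {1..<\<alpha> k}). f (\<lambda>i. if i \<in> K then g i else 0)) =
    (\<Prod>(K, g)\<in>Sigma UNIV (\<lambda>K. PiE K (\<lambda>k. {1..<\<alpha> k})). f (\<lambda>i. if i \<in> K then g i else 0))"
    by (rule prod.Sigma) (auto intro: finite_PiE)
  also have "\<dots> = (\<Prod>s\<in>idx \<alpha>. f s)"
  proof (rule prod.reindex_bij_witness[of _ "\<lambda>s. ({i. s i \<noteq> 0}, restrict s {i. s i \<noteq> 0})"
        "\<lambda>(K, g). \<lambda>i. if i \<in> K then g i else 0"])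
    fix x assume "x \<in> Sigma UNIV (\<lambda>K. PiE K (\<lambda>k. {1..<\<alpha> k}))"
    then obtain K g where x: "x = (K, g)" and g: "g \<in> PiE K (\<lambda>k. {1..<\<alpha> k})" by auto
    have g1: "g i \<noteq> 0 \<and> g i < \<alpha> i" if "i \<in> K" for i using PiE_mem[OF g that] by auto
    have K: "{i. (if i \<in> K then g i else 0) \<noteq> 0} = K" using g1 by auto
    have gu: "g i = undefined" if "i \<notin> K" for i using g that by (auto simp: PiE_def extensional_def)
    show "({i. (case x of (K, g) \<Rightarrow> \<lambda>i. if i \<in> K then g i else 0) i \<noteq> 0},
         restrict (case x of (K, g) \<Rightarrow> \<lambda>i. if i \<in> K then g i else 0)
          {i. (case x of (K, g) \<Rightarrow> \<lambda>i. if i \<in> K then g i else 0) i \<noteq> 0}) = x"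
      unfolding x prod.case K using gu by (auto simp: fun_eq_iff)
    show "(case x of (K, g) \<Rightarrow> \<lambda>i. if i \<in> K then g i else 0) \<in> idx \<alpha>"
      using g1 assms by (auto simp: x idx_iff)
    show "f (case x of (K, g) \<Rightarrow> \<lambda>i. if i \<in> K then g i else 0) =
      (case x of (K, g) \<Rightarrow> f (\<lambda>i. if i \<in> K then g i else 0))" by (simp add: x)
  qed (auto simp: idx_iff fun_eq_iff Suc_le_eq)
  finally show ?thesis ..
qed

section \<open>The factors with a fixed set of large roots\<close>

definition face_denom :: "('i::finite \<Rightarrow> nat) \<Rightarrow> ('i coeff \<Rightarrow> complex) \<Rightarrow> 'i set \<Rightarrow> complex" where
  "face_denom \<alpha> c K = (\<Prod>i\<in>- K. c (B1 i) ^ prod_pred \<alpha> K) * (\<Prod>k\<in>K. c (B2 k) ^ prod_pred \<alpha> (K - {k}))"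

text \<open>For \<open>I = - K\<close> this is the value of \<open>phi_second\<close>, while
  \<open>face_denom\<close> is that of \<open>phi_first\<close> without \<open>A0\<close>. The
  latter clears the denominators in the product of all factors with large roots at
  \<open>K\<close>.\<close>

definition face_num :: "('i::finite \<Rightarrow> nat) \<Rightarrow> ('i coeff \<Rightarrow> complex) \<Rightarrow> 'i set \<Rightarrow> complex" where
  "face_num \<alpha> c K = c A1 ^ prod_pred \<alpha> K * (\<Prod>i\<in>- K. c (B0 i) ^ prod_pred \<alpha> K) *
     (\<Prod>k\<in>K. c (B1 k) ^ prod_pred \<alpha> (K - {k}))"

definition face_sign :: "('i::finite \<Rightarrow> nat) \<Rightarrow> 'i set \<Rightarrow> int" where
  "face_sign \<alpha> K = (-1) ^ (1 + (card (- K) + 1) * lcm_pred \<alpha> K + (\<Sum>k\<in>K. lcm_pred \<alpha> K div (\<alpha> k - 1)))"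

lemma prod_pred_factors:
  fixes K :: "'i::finite set"
  assumes \<alpha>: "\<And>i. 2 \<le> \<alpha> i"
  shows "prod_pred \<alpha> K = lcm_pred \<alpha> K * (prod_pred \<alpha> K div lcm_pred \<alpha> K)"
    and "k \<in> K \<Longrightarrow> prod_pred \<alpha> (K - {k}) = lcm_pred \<alpha> K div (\<alpha> k - 1) * (prod_pred \<alpha> K div lcm_pred \<alpha> K)"
proof -
  show 1: "prod_pred \<alpha> K = lcm_pred \<alpha> K * (prod_pred \<alpha> K div lcm_pred \<alpha> K)"
    using lcm_pred_dvd_prod_pred[of K \<alpha>] by simp
  assume k: "k \<in> K"
  obtain l where l: "lcm_pred \<alpha> K = (\<alpha> k - 1) * l"
    using lcm_pred_dvd[OF k, of \<alpha>] by (auto elim: dvdE)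
  have pos: "0 < \<alpha> k - 1" using \<alpha>[of k] by simp
  have "(\<alpha> k - 1) * prod_pred \<alpha> (K - {k}) = (\<alpha> k - 1) * (l * (prod_pred \<alpha> K div lcm_pred \<alpha> K))"
    using prod_pred_remove[of K k \<alpha>] k 1 l by (metis finite mult.assoc)
  then have "prod_pred \<alpha> (K - {k}) = l * (prod_pred \<alpha> K div lcm_pred \<alpha> K)"
    using pos by (metis mult_cancel1 neq0_conv)
  then show "prod_pred \<alpha> (K - {k}) = lcm_pred \<alpha> K div (\<alpha> k - 1) * (prod_pred \<alpha> K div lcm_pred \<alpha> K)"
    using pos by (simp add: l)
qed

text \<open>\<open>A\<close> is kept free, to be \<open>c A0\<close> when both terms survive and 0
  when the second dominates. The product is \<open>prod_root_tuples\<close> with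
  \<open>B = - (c A1 * P)\<close>; what remains is clearing denominators.\<close>

lemma face_product:
  fixes c :: "'i::finite coeff \<Rightarrow> complex"
  assumes \<alpha>: "\<And>i. 2 \<le> \<alpha> i" and c: "\<And>v. c v \<noteq> 0"
    and r: "\<And>i. bij_betw (r i) {1..<\<alpha> i} {w. w ^ (\<alpha> i - 1) = - c (B1 i) / c (B2 i)}"
  defines "L \<equiv> \<lambda>K. lcm_pred \<alpha> K"
  shows "(\<Prod>g\<in>PiE K (\<lambda>k. {1..<\<alpha> k}). A + c A1 * ((\<Prod>i\<in>- K. - c (B0 i) / c (B1 i)) * (\<Prod>k\<in>K. r k (g k)))) * face_denom \<alpha> c K =
    (A ^ L K * (\<Prod>i\<in>- K. c (B1 i) ^ L K) * (\<Prod>k\<in>K. c (B2 k) ^ (L K div (\<alpha> k - 1))) +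
     of_int (face_sign \<alpha> K) *
     (c A1 ^ L K * (\<Prod>i\<in>- K. c (B0 i) ^ L K) * (\<Prod>k\<in>K. c (B1 k) ^ (L K div (\<alpha> k - 1))))) ^
    (prod_pred \<alpha> K div L K)"
proof -
  define e where "e k = L K div (\<alpha> k - 1)" for k
  define G where "G = prod_pred \<alpha> K div L K"
  define P where "P = (\<Prod>i\<in>- K. - c (B0 i) / c (B1 i))"
  define X where "X = A ^ L K - (- (c A1 * P)) ^ L K * (\<Prod>k\<in>K. (- c (B1 k) / c (B2 k)) ^ e k)"
  define D where "D = (\<Prod>i\<in>- K. c (B1 i) ^ L K) * (\<Prod>k\<in>K. c (B2 k) ^ e k)"
  have "(\<Prod>g\<in>PiE K (\<lambda>k. {1..<\<alpha> k}). A + c A1 * (P * (\<Prod>k\<in>K. r k (g k)))) =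
     (\<Prod>g\<in>PiE K (\<lambda>k. {1..<\<alpha> k}). A - (- (c A1 * P)) * (\<Prod>k\<in>K. r k (g k)))"
    by (simp add: mult.assoc)
  also have "\<dots> = X ^ G"
    unfolding X_def G_def L_def e_def using \<alpha> c r by (intro prod_root_tuples) auto
  finally have 1: "(\<Prod>g\<in>PiE K (\<lambda>k. {1..<\<alpha> k}). A + c A1 * (P * (\<Prod>k\<in>K. r k (g k)))) = X ^ G" .
  have 2: "face_denom \<alpha> c K = D ^ G"
  proof -
    have "(\<Prod>i\<in>- K. c (B1 i) ^ prod_pred \<alpha> K) = (\<Prod>i\<in>- K. c (B1 i) ^ L K) ^ G"
      unfolding prod_power_distrib power_mult[symmetric]
      using prod_pred_factors(1)[of \<alpha> K, OF \<alpha>] by (simp add: L_def G_def)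
    moreover have "(\<Prod>k\<in>K. c (B2 k) ^ prod_pred \<alpha> (K - {k})) = (\<Prod>k\<in>K. c (B2 k) ^ e k) ^ G"
      unfolding prod_power_distrib power_mult[symmetric]
      using prod_pred_factors(2)[of \<alpha> _ K, OF \<alpha>] by (intro prod.cong) (simp_all add: L_def G_def e_def)
    ultimately show ?thesis by (simp add: face_denom_def D_def power_mult_distrib)
  qed
  have P: "P ^ L K * (\<Prod>i\<in>- K. c (B1 i) ^ L K) = (-1) ^ (card (- K) * L K) * (\<Prod>i\<in>- K. c (B0 i) ^ L K)"
  proof -
    have "P ^ L K * (\<Prod>i\<in>- K. c (B1 i) ^ L K) = (\<Prod>i\<in>- K. (-1) ^ L K * c (B0 i) ^ L K)"
      unfolding P_def prod_power_distrib prod.distrib[symmetric]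
      by (rule prod.cong) (simp_all add: c power_mult_distrib[symmetric])
    then show ?thesis by (simp add: prod.distrib power_mult[symmetric] mult.commute)
  qed
  have Q: "(\<Prod>k\<in>K. (- c (B1 k) / c (B2 k)) ^ e k) * (\<Prod>k\<in>K. c (B2 k) ^ e k) =
     (-1) ^ (\<Sum>k\<in>K. e k) * (\<Prod>k\<in>K. c (B1 k) ^ e k)"
  proof -
    have "(\<Prod>k\<in>K. (- c (B1 k) / c (B2 k)) ^ e k) * (\<Prod>k\<in>K. c (B2 k) ^ e k) = (\<Prod>k\<in>K. (-1) ^ e k * c (B1 k) ^ e k)"
      unfolding prod.distrib[symmetric]
      by (rule prod.cong) (simp_all add: c power_mult_distrib[symmetric])
    then show ?thesis by (simp add: prod.distrib power_sum)
  qed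
  \<comment> \<open>The sign collects \<open>L K\<close> from the minus in front of
    \<open>c A1\<close>, \<open>card (- K) * L K\<close> from the small roots and the sum of the
    \<open>e k\<close> from the large ones; the subtraction in \<open>X\<close> adds the 1.\<close>
  have "(- (c A1 * P)) ^ L K * (\<Prod>k\<in>K. (- c (B1 k) / c (B2 k)) ^ e k) * D =
      (-1) ^ L K * c A1 ^ L K * (P ^ L K * (\<Prod>i\<in>- K. c (B1 i) ^ L K)) *
      ((\<Prod>k\<in>K. (- c (B1 k) / c (B2 k)) ^ e k) * (\<Prod>k\<in>K. c (B2 k) ^ e k))"
    by (subst power_minus) (simp add: D_def power_mult_distrib mult_ac)
  also have "\<dots> = - of_int (face_sign \<alpha> K) *
     (c A1 ^ L K * (\<Prod>i\<in>- K. c (B0 i) ^ L K) * (\<Prod>k\<in>K. c (B1 k) ^ e k))"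
    unfolding P Q by (simp add: face_sign_def e_def L_def power_add mult_ac)
  finally have "X * D = A ^ L K * D + of_int (face_sign \<alpha> K) *
     (c A1 ^ L K * (\<Prod>i\<in>- K. c (B0 i) ^ L K) * (\<Prod>k\<in>K. c (B1 k) ^ e k))"
    unfolding X_def left_diff_distrib by simp
  then show ?thesis
    unfolding 2 1[unfolded P_def] power_mult_distrib[symmetric] by (simp add: G_def D_def e_def mult.assoc)
qed

lemma face_product_eq_GCD:
  fixes c :: "'i::finite coeff \<Rightarrow> complex"
  assumes \<alpha>: "\<And>i. 2 \<le> \<alpha> i" and c: "\<And>v. c v \<noteq> 0"
    and r: "\<And>i. bij_betw (r i) {1..<\<alpha> i} {w. w ^ (\<alpha> i - 1) = - c (B1 i) / c (B2 i)}"
  shows "(\<Prod>g\<in>PiE K (\<lambda>k. {1..<\<alpha> k}). c A0 + c A1 * ((\<Prod>i\<in>- K. - c (B0 i) / c (B1 i)) * (\<Prod>k\<in>K. r k (g k)))) * face_denom \<alpha> c K =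
    mev c (GCD_op (phi_binomial \<alpha> (- K) K))"
  unfolding mev_GCD_phi[of \<alpha>, OF \<alpha>] by (subst face_product[OF \<alpha> c r]) (simp add: face_sign_def)

text \<open>This is \<open>face_product\<close> at \<open>A = 0\<close>, where the first term
  vanishes because \<open>lcm_pred \<alpha> K\<close> is positive.\<close>

lemma face_product_dominated:
  fixes c :: "'i::finite coeff \<Rightarrow> complex"
  assumes \<alpha>: "\<And>i. 2 \<le> \<alpha> i" and c: "\<And>v. c v \<noteq> 0"
    and r: "\<And>i. bij_betw (r i) {1..<\<alpha> i} {w. w ^ (\<alpha> i - 1) = - c (B1 i) / c (B2 i)}"
  shows "(\<Prod>g\<in>PiE K (\<lambda>k. {1..<\<alpha> k}). c A1 * ((\<Prod>i\<in>- K. - c (B0 i) / c (B1 i)) * (\<Prod>k\<in>K. r k (g k)))) * face_denom \<alpha> c K =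
    of_int (face_sign \<alpha> K ^ (prod_pred \<alpha> K div lcm_pred \<alpha> K)) * face_num \<alpha> c K"
proof -
  define L where "L = lcm_pred \<alpha> K"
  define G where "G = prod_pred \<alpha> K div L"
  have "0 < L" unfolding L_def using \<alpha> by (intro lcm_pred_pos) auto
  then have "(\<Prod>g\<in>PiE K (\<lambda>k. {1..<\<alpha> k}). c A1 * ((\<Prod>i\<in>- K. - c (B0 i) / c (B1 i)) * (\<Prod>k\<in>K. r k (g k)))) * face_denom \<alpha> c K =
    (of_int (face_sign \<alpha> K) * (c A1 ^ L * (\<Prod>i\<in>- K. c (B0 i) ^ L) * (\<Prod>k\<in>K. c (B1 k) ^ (L div (\<alpha> k - 1))))) ^ G"
    using face_product[of \<alpha> c r 0 K, OF \<alpha> c r] by (simp add: L_def G_def zero_power)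
  also note power_mult_distrib
  also have "(c A1 ^ L * (\<Prod>i\<in>- K. c (B0 i) ^ L) * (\<Prod>k\<in>K. c (B1 k) ^ (L div (\<alpha> k - 1)))) ^ G = face_num \<alpha> c K"
  proof -
    have 1: "prod_pred \<alpha> K = L * G"
      using prod_pred_factors(1)[of \<alpha> K, OF \<alpha>] by (simp add: L_def G_def)
    have "(\<Prod>k\<in>K. c (B1 k) ^ prod_pred \<alpha> (K - {k})) = (\<Prod>k\<in>K. c (B1 k) ^ (L div (\<alpha> k - 1))) ^ G"
      unfolding prod_power_distrib power_mult[symmetric]
      using prod_pred_factors(2)[of \<alpha> _ K, OF \<alpha>] by (intro prod.cong) (simp_all add: L_def G_def)
    then show ?thesis
      by (simp add: face_num_def 1 power_mult_distrib prod_power_distrib power_mult)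
  qed
  finally show ?thesis by (simp add: power_mult_distrib L_def G_def)
qed

section \<open>Exponent count for the monomial \<open>mu\<close>\<close>

lemma prod_prod_powers:
  fixes b :: "'i::finite \<Rightarrow> 'a::comm_ring_1"
  assumes "finite F"
  shows "(\<Prod>K\<in>F. \<Prod>i\<in>S K. b i ^ e i K) = (\<Prod>i\<in>UNIV. b i ^ (\<Sum>K | K \<in> F \<and> i \<in> S K. e i K))"
proof -
  have "(\<Prod>K\<in>F. \<Prod>i\<in>S K. b i ^ e i K) = (\<Prod>K\<in>F. \<Prod>i\<in>UNIV. if i \<in> S K then b i ^ e i K else 1)"
    by (simp add: prod.If_cases)
  also have "\<dots> = (\<Prod>i\<in>UNIV. \<Prod>K\<in>F. if i \<in> S K then b i ^ e i K else 1)"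
    by (rule prod.swap)
  also have "\<dots> = (\<Prod>i\<in>UNIV. b i ^ (\<Sum>K | K \<in> F \<and> i \<in> S K. e i K))"
    using assms by (simp add: power_sum prod.inter_filter[symmetric] Collect_conj_eq)
  finally show ?thesis .
qed

lemma sum_prod_pred_remove:
  fixes i :: "'i::finite"
  shows "(\<Sum>K | Q (card K) \<and> i \<in> K. prod_pred \<alpha> (K - {i})) = (\<Sum>K | Q (Suc (card K)) \<and> i \<notin> K. prod_pred \<alpha> K)"
proof (rule sum.reindex_bij_witness[of _ "insert i" "\<lambda>K. K - {i}"])
  fix K assume "K \<in> {K. Q (card K) \<and> i \<in> K}"
  then show "K - {i} \<in> {K. Q (Suc (card K)) \<and> i \<notin> K}"
    using card.remove[of K i] by auto
qed (auto simp: insert_absorb)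

text \<open>Expand the product of the factors \<open>(\<alpha> k - 1) + 1\<close>.\<close>

lemma prod_eq_sum_prod_pred:
  fixes i :: "'i::finite"
  assumes "\<And>i. 2 \<le> \<alpha> i"
  shows "(\<Prod>k\<in>UNIV - {i}. \<alpha> k) = (\<Sum>K | i \<notin> K. prod_pred \<alpha> K)"
proof -
  have "(\<Prod>k\<in>UNIV - {i}. \<alpha> k) = (\<Prod>k\<in>UNIV - {i}. (\<alpha> k - 1) + 1)"
    using assms by (intro prod.cong refl) (metis Suc_1 Suc_eq_plus1 Suc_le_eq le_add_diff_inverse2 less_imp_le)
  also have "\<dots> = (\<Sum>K\<in>Pow (UNIV - {i}). prod_pred \<alpha> K)"
    by (subst prod_add) (simp_all add: prod_pred_def)
  also have "Pow (UNIV - {i}) = {K. i \<notin> K}" by auto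
  finally show ?thesis .
qed

text \<open>Exponents are compared variable by variable. Removing \<open>i\<close> from
  \<open>K\<close> lowers the cardinality by one, so the powers of \<open>B1 i\<close> in
  \<open>face_num\<close> with \<open>q < card K\<close> match those in \<open>face_denom\<close>
  with \<open>q \<le> card K\<close> and cancel.\<close>

lemma face_monomial_identity:
  fixes c :: "'i::finite coeff \<Rightarrow> complex"
  assumes \<alpha>: "\<And>i. 2 \<le> \<alpha> i" and q: "1 \<le> q"
  shows "(\<Prod>i\<in>UNIV. c (B2 i) ^ (\<Prod>k\<in>UNIV - {i}. \<alpha> k)) * c A0 ^ (\<Sum>K | card K < q. prod_pred \<alpha> K) *
      (\<Prod>K | q < card K. face_num \<alpha> c K) =
    mev c (mu \<alpha> q) * (\<Prod>K | q \<le> card K. face_denom \<alpha> c K)"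
proof -
  have le: "card K \<le> CARD('i)" for K :: "'i set" by (rule card_mono) auto
  have lt: "card K < CARD('i)" if "i \<notin> K" for K :: "'i set" and i
    using that by (intro psubset_card_mono) auto
  have num: "(\<Prod>K | q < card K. face_num \<alpha> c K) = c A1 ^ (\<Sum>K | q < card K. prod_pred \<alpha> K) *
     (\<Prod>i\<in>UNIV. c (B0 i) ^ (\<Sum>K | q < card K \<and> i \<notin> K. prod_pred \<alpha> K)) *
     (\<Prod>i\<in>UNIV. c (B1 i) ^ (\<Sum>K | q \<le> card K \<and> i \<notin> K. prod_pred \<alpha> K))"
    using sum_prod_pred_remove[where Q = "\<lambda>n. q < n" and \<alpha> = \<alpha>]
    by (simp add: face_num_def prod.distrib power_sum[symmetric] prod_prod_powers less_Suc_eq_le)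
  have den: "(\<Prod>K | q \<le> card K. face_denom \<alpha> c K) =
     (\<Prod>i\<in>UNIV. c (B1 i) ^ (\<Sum>K | q \<le> card K \<and> i \<notin> K. prod_pred \<alpha> K)) *
     (\<Prod>i\<in>UNIV. c (B2 i) ^ (\<Sum>K | q \<le> Suc (card K) \<and> i \<notin> K. prod_pred \<alpha> K))"
    using sum_prod_pred_remove[where Q = "\<lambda>n. q \<le> n" and \<alpha> = \<alpha>]
    by (simp add: face_denom_def prod.distrib prod_prod_powers)
  \<comment> \<open>The summand 1 is the empty set, which the range \<open>{1..q-1}\<close> leaves
    out.\<close>
  have a0: "(\<Sum>K | card K < q. prod_pred \<alpha> K) = 1 + (\<Sum>K | card K \<in> {1..q-1}. prod_pred \<alpha> K)"
  proof -
    have "{K :: 'i set. card K < q} = insert {} {K. card K \<in> {1..q-1}}"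
      using q by (auto simp: card_gt_0_iff Suc_le_eq)
    then show ?thesis by (simp add: prod_pred_def)
  qed
  have a1: "(\<Sum>K | q < card K. prod_pred \<alpha> K) = (\<Sum>K | card K \<in> {q+1..CARD('i)}. prod_pred \<alpha> K)"
    using le by (intro sum.cong) auto
  have b0: "(\<Sum>K | q < card K \<and> i \<notin> K. prod_pred \<alpha> K) =
      (\<Sum>K | card K \<in> {q+1..CARD('i)-1} \<and> i \<notin> K. prod_pred \<alpha> K)" for i
    by (intro sum.cong) (auto dest: lt)
  \<comment> \<open>The subsets avoiding \<open>i\<close> with at least \<open>q - 1\<close>
    elements account for \<open>face_denom\<close>; the smaller ones give the exponent in
    \<open>mu\<close>, where the empty set is counted by \<open>delta q\<close>.\<close>
  have b2: "(\<Prod>k\<in>UNIV - {i}. \<alpha> k) = delta q + (\<Sum>K | card K \<in> {1..q-2} \<and> i \<notin> K. prod_pred \<alpha> K) +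
      (\<Sum>K | q \<le> Suc (card K) \<and> i \<notin> K. prod_pred \<alpha> K)" for i
  proof -
    have U: "{K. i \<notin> K} = {K. Suc (card K) < q \<and> i \<notin> K} \<union> {K. q \<le> Suc (card K) \<and> i \<notin> K}" by auto
    have "(\<Prod>k\<in>UNIV - {i}. \<alpha> k) = (\<Sum>K | i \<notin> K. prod_pred \<alpha> K)"
      by (rule prod_eq_sum_prod_pred[of \<alpha>, OF \<alpha>])
    also have "\<dots> = sum (prod_pred \<alpha>) ({K. Suc (card K) < q \<and> i \<notin> K} \<union> {K. q \<le> Suc (card K) \<and> i \<notin> K})"
      by (rule arg_cong[OF U])
    also have "\<dots> = (\<Sum>K | Suc (card K) < q \<and> i \<notin> K. prod_pred \<alpha> K) +
       (\<Sum>K | q \<le> Suc (card K) \<and> i \<notin> K. prod_pred \<alpha> K)"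
      by (rule sum.union_disjoint) auto
    finally have "(\<Prod>k\<in>UNIV - {i}. \<alpha> k) = (\<Sum>K | Suc (card K) < q \<and> i \<notin> K. prod_pred \<alpha> K) +
       (\<Sum>K | q \<le> Suc (card K) \<and> i \<notin> K. prod_pred \<alpha> K)" .
    moreover have "(\<Sum>K | Suc (card K) < q \<and> i \<notin> K. prod_pred \<alpha> K) =
       delta q + (\<Sum>K | card K \<in> {1..q-2} \<and> i \<notin> K. prod_pred \<alpha> K)"
    proof (cases "q \<le> 1")
      case True
      then show ?thesis by (simp add: delta_def)
    next
      case False
      then have "{K :: 'i set. Suc (card K) < q \<and> i \<notin> K} = insert {} {K. card K \<in> {1..q-2} \<and> i \<notin> K}"
        by (auto simp: card_gt_0_iff Suc_le_eq)
      then show ?thesis using False by (simp add: prod_pred_def delta_def)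
    qed
    ultimately show ?thesis by simp
  qed
  have mu: "mev c (mu \<alpha> q) = c A0 ^ (\<Sum>K | card K < q. prod_pred \<alpha> K) *
      c A1 ^ (\<Sum>K | q < card K. prod_pred \<alpha> K) *
      ((\<Prod>i\<in>UNIV. c (B0 i) ^ (\<Sum>K | q < card K \<and> i \<notin> K. prod_pred \<alpha> K)) *
       (\<Prod>i\<in>UNIV. c (B2 i) ^ (delta q + (\<Sum>K | card K \<in> {1..q-2} \<and> i \<notin> K. prod_pred \<alpha> K))))"
    unfolding mu_def a0 a1 b0 by (simp add: mev_mult mev.hom_power mev.hom_prod prod.distrib)
  have b2': "(\<Prod>i\<in>UNIV. c (B2 i) ^ (\<Prod>k\<in>UNIV - {i}. \<alpha> k)) =
      (\<Prod>i\<in>UNIV. c (B2 i) ^ (delta q + (\<Sum>K | card K \<in> {1..q-2} \<and> i \<notin> K. prod_pred \<alpha> K))) *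
      (\<Prod>i\<in>UNIV. c (B2 i) ^ (\<Sum>K | q \<le> Suc (card K) \<and> i \<notin> K. prod_pred \<alpha> K))"
    unfolding b2 power_add[of _ "delta q + _"] by (rule prod.distrib)
  show ?thesis
    unfolding num den mu b2' by (simp only: mult_ac)
qed

section \<open>The limit and the initial form\<close>

lemma mev_phi:
  fixes \<alpha> :: "'i::finite \<Rightarrow> nat"
  assumes "p + q = CARD('i)"
  shows "mev c (phi \<alpha> p q) = mev c (mu \<alpha> q) * (\<Prod>K | card K = q. mev c (GCD_op (phi_binomial \<alpha> (- K) K)))"
proof -
  have "(\<Prod>(I, K) | I \<union> K = UNIV \<and> I \<inter> K = {} \<and> card I = p \<and> card K = q. GCD_op (phi_binomial \<alpha> I K)) =
     (\<Prod>K | card K = q. GCD_op (phi_binomial \<alpha> (- K) K))"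
  proof (rule prod.reindex_bij_witness[of _ "\<lambda>K. (- K, K)" snd])
    fix x :: "'i set \<times> 'i set"
    assume "x \<in> {(I, K). I \<union> K = UNIV \<and> I \<inter> K = {} \<and> card I = p \<and> card K = q}"
    then have "fst x = - snd x" "card (snd x) = q" by (auto simp: set_eq_iff)
    then show "(- snd x, snd x) = x" "snd x \<in> {K. card K = q}"
      "GCD_op (phi_binomial \<alpha> (- snd x) (snd x)) = (case x of (I, K) \<Rightarrow> GCD_op (phi_binomial \<alpha> I K))"
      by (auto simp: prod_eq_iff split_beta)
  next
    fix K :: "'i set" assume "K \<in> {K. card K = q}"
    then show "(- K, K) \<in> {(I, K). I \<union> K = UNIV \<and> I \<inter> K = {} \<and> card I = p \<and> card K = q}"
      using assms by (auto simp: Compl_eq_Diff_UNIV card_Diff_subset)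
  qed auto
  then show ?thesis by (simp add: phi_def mev_mult mev.hom_prod)
qed

lemma phi_nonzero:
  fixes \<alpha> :: "'i::finite \<Rightarrow> nat"
  assumes \<alpha>: "\<And>i. 2 \<le> \<alpha> i" and pq: "p + q = CARD('i)"
  shows "phi \<alpha> p q \<noteq> 0"
proof -
  \<comment> \<open>At this point every reduced binomial is a power of 2 with positive exponent,
    plus or minus 1, hence nonzero.\<close>
  define c :: "'i coeff \<Rightarrow> complex" where "c v = (if v = A0 then 2 else 1)" for v
  have "mev c (mu \<alpha> q) \<noteq> 0"
    by (simp add: mu_def mev_mult mev.hom_power mev.hom_prod c_def)
  moreover have "mev c (GCD_op (phi_binomial \<alpha> (- K) K)) \<noteq> 0" for K
  proof -
    have "0 < lcm_pred \<alpha> K" using \<alpha> by (intro lcm_pred_pos) auto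
    then have "(2::real) ^ 1 \<le> 2 ^ lcm_pred \<alpha> K" by (intro power_increasing) auto
    then have n: "1 < norm ((2::complex) ^ lcm_pred \<alpha> K)" by (simp add: norm_power)
    have "(2::complex) ^ lcm_pred \<alpha> K \<noteq> (-1) ^ n" for n
    proof
      assume "(2::complex) ^ lcm_pred \<alpha> K = (-1) ^ n"
      then have "norm ((2::complex) ^ lcm_pred \<alpha> K) = 1" by (simp add: norm_power)
      with n show False by simp
    qed
    then show ?thesis
      unfolding mev_GCD_phi[of \<alpha>, OF \<alpha>] by (simp add: c_def)
  qed
  ultimately have "mev c (phi \<alpha> p q) \<noteq> 0"
    unfolding mev_phi[OF pq] by simp
  then show ?thesis by auto
qed

text \<open>Tuples are grouped by their support \<open>K\<close>, and these sets by comparing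
  \<open>card K\<close> with \<open>q\<close>. After multiplication by all \<open>face_denom\<close>
  with \<open>q \<le> card K\<close>, the middle group gives the GCD factors; the other two and the
  powers of \<open>B2 i\<close> combine to \<open>mu\<close> by
  \<open>face_monomial_identity\<close>, up to the signs of the group with
  \<open>q < card K\<close>.\<close>

lemma limit_eq_phi:
  fixes c :: "'i::finite coeff \<Rightarrow> complex"
  assumes \<alpha>: "\<And>i. 2 \<le> \<alpha> i" and c: "\<And>v. c v \<noteq> 0"
    and r: "\<And>i. bij_betw (r i) {1..<\<alpha> i} {w. w ^ (\<alpha> i - 1) = - c (B1 i) / c (B2 i)}"
    and r0: "\<And>i. r i 0 = - c (B0 i) / c (B1 i)"
    and pq: "p + q = CARD('i)" and q: "1 \<le> q"
  shows "(\<Prod>i\<in>UNIV. c (B2 i) ^ (\<Prod>k\<in>UNIV - {i}. \<alpha> k)) *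
        (\<Prod>s\<in>idx \<alpha>. (if card {i. s i \<noteq> 0} \<le> q then c A0 else 0) +
          (if q \<le> card {i. s i \<noteq> 0} then c A1 * (\<Prod>i\<in>UNIV. r i (s i)) else 0)) =
     of_int (\<Prod>K | q < card K. face_sign \<alpha> K ^ (prod_pred \<alpha> K div lcm_pred \<alpha> K)) * mev c (phi \<alpha> p q)"
proof -
  let ?B = "\<Prod>i\<in>UNIV. c (B2 i) ^ (\<Prod>k\<in>UNIV - {i}. \<alpha> k)"
  define Y where "Y K g = c A1 * ((\<Prod>i\<in>- K. - c (B0 i) / c (B1 i)) * (\<Prod>k\<in>K. r k (g k)))" for K g
  define T where "T K = (\<Prod>g\<in>PiE K (\<lambda>k. {1..<\<alpha> k}). (if card K \<le> q then c A0 else 0) + (if q \<le> card K then Y K g else 0))" for K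
  have \<alpha>0: "0 < \<alpha> i" for i using \<alpha>[of i] by simp
  have "(\<Prod>s\<in>idx \<alpha>. (if card {i. s i \<noteq> 0} \<le> q then c A0 else 0) +
          (if q \<le> card {i. s i \<noteq> 0} then c A1 * (\<Prod>i\<in>UNIV. r i (s i)) else 0)) = (\<Prod>K\<in>UNIV. T K)"
    unfolding prod_idx_by_support[of \<alpha>, OF \<alpha>0] T_def
  proof (intro prod.cong refl)
    fix K g assume g: "g \<in> PiE K (\<lambda>k. {1..<\<alpha> k})"
    have K: "{i. (if i \<in> K then g i else 0) \<noteq> 0} = K"
      using PiE_mem[OF g] by force
    have "(\<Prod>i\<in>UNIV. r i (if i \<in> K then g i else 0)) = (\<Prod>i\<in>UNIV. if i \<in> K then r i (g i) else - c (B0 i) / c (B1 i))"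
      by (intro prod.cong) (auto simp: r0)
    also have "\<dots> = (\<Prod>k\<in>K. r k (g k)) * (\<Prod>i\<in>- K. - c (B0 i) / c (B1 i))"
      by (subst prod.If_cases) (auto simp: Compl_eq[symmetric])
    finally show "(if card {i. (if i \<in> K then g i else 0) \<noteq> 0} \<le> q then c A0 else 0) +
        (if q \<le> card {i. (if i \<in> K then g i else 0) \<noteq> 0} then c A1 * (\<Prod>i\<in>UNIV. r i (if i \<in> K then g i else 0)) else 0) =
        (if card K \<le> q then c A0 else 0) + (if q \<le> card K then Y K g else 0)"
      unfolding K by (simp add: Y_def mult.commute)
  qed
  also have "(\<Prod>K\<in>UNIV. T K) = (\<Prod>K | card K < q. T K) * ((\<Prod>K | card K = q. T K) * (\<Prod>K | q < card K. T K))"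
  proof -
    have U: "(UNIV :: 'i set set) = {K. card K < q} \<union> ({K. card K = q} \<union> {K. q < card K})" by auto
    show ?thesis
      by (subst U, subst prod.union_disjoint, simp, simp, force, subst prod.union_disjoint) auto
  qed
  finally have split: "(\<Prod>s\<in>idx \<alpha>. (if card {i. s i \<noteq> 0} \<le> q then c A0 else 0) +
          (if q \<le> card {i. s i \<noteq> 0} then c A1 * (\<Prod>i\<in>UNIV. r i (s i)) else 0)) =
      (\<Prod>K | card K < q. T K) * ((\<Prod>K | card K = q. T K) * (\<Prod>K | q < card K. T K))" .
  have lt: "(\<Prod>K | card K < q. T K) = c A0 ^ (\<Sum>K | card K < q. prod_pred \<alpha> K)"
    unfolding power_sum by (intro prod.cong) (auto simp: T_def card_PiE prod_pred_def)
  have eq: "(\<Prod>K | card K = q. T K) * (\<Prod>K | card K = q. face_denom \<alpha> c K) =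
      (\<Prod>K | card K = q. mev c (GCD_op (phi_binomial \<alpha> (- K) K)))"
    unfolding prod.distrib[symmetric]
    by (intro prod.cong refl) (use face_product_eq_GCD[of \<alpha> c r, OF \<alpha> c r] in \<open>simp add: T_def Y_def\<close>)
  have gt: "(\<Prod>K | q < card K. T K) * (\<Prod>K | q < card K. face_denom \<alpha> c K) =
      of_int (\<Prod>K | q < card K. face_sign \<alpha> K ^ (prod_pred \<alpha> K div lcm_pred \<alpha> K)) * (\<Prod>K | q < card K. face_num \<alpha> c K)"
    unfolding prod.distrib[symmetric] of_int_prod
    by (intro prod.cong refl) (use face_product_dominated[of \<alpha> c r, OF \<alpha> c r] in \<open>simp add: T_def Y_def\<close>)
  have den: "(\<Prod>K | q \<le> card K. face_denom \<alpha> c K) = (\<Prod>K | card K = q. face_denom \<alpha> c K) * (\<Prod>K | q < card K. face_denom \<alpha> c K)"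
  proof -
    have "{K :: 'i set. q \<le> card K} = {K. card K = q} \<union> {K. q < card K}" by auto
    then show ?thesis by (simp only:) (rule prod.union_disjoint, auto)
  qed
  have den0: "(\<Prod>K | q \<le> card K. face_denom \<alpha> c K) \<noteq> 0"
    using c by (simp add: face_denom_def)
  let ?e = "of_int (\<Prod>K | q < card K. face_sign \<alpha> K ^ (prod_pred \<alpha> K div lcm_pred \<alpha> K)) :: complex"
  let ?l = "\<Prod>K | card K < q. T K" and ?m = "\<Prod>K | card K = q. T K" and ?g = "\<Prod>K | q < card K. T K"
  let ?G = "\<Prod>K | card K = q. mev c (GCD_op (phi_binomial \<alpha> (- K) K))"
  \<comment> \<open>Each group is paired with its own denominators; their nonzero product is
    cancelled at the end.\<close>
  have "?B * (?l * (?m * ?g)) * (\<Prod>K | q \<le> card K. face_denom \<alpha> c K) =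
     ?B * ?l * ((?m * (\<Prod>K | card K = q. face_denom \<alpha> c K)) * (?g * (\<Prod>K | q < card K. face_denom \<alpha> c K)))"
    unfolding den by (simp only: mult_ac)
  also have "\<dots> = ?e * ?G * (?B * c A0 ^ (\<Sum>K | card K < q. prod_pred \<alpha> K) * (\<Prod>K | q < card K. face_num \<alpha> c K))"
    unfolding eq gt lt by (simp only: mult_ac)
  also have "\<dots> = ?e * ?G * (mev c (mu \<alpha> q) * (\<Prod>K | q \<le> card K. face_denom \<alpha> c K))"
    by (subst face_monomial_identity[OF \<alpha> q]) (rule refl)
  also have "\<dots> = ?e * mev c (phi \<alpha> p q) * (\<Prod>K | q \<le> card K. face_denom \<alpha> c K)"
    unfolding mev_phi[OF pq] by (simp only: mult_ac)
  finally show ?thesis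
    unfolding split using den0 by simp
qed

lemma initial_form_uminus: "initial_form \<omega> (- P) = - initial_form \<omega> P"
proof -
  have "Poly_Mapping.keys (- P) = Poly_Mapping.keys P" by simp
  then show ?thesis
    unfolding initial_form_def by (simp add: sum_negf single_uminus)
qed

theorem proposition7p1:
  fixes \<alpha> :: "'i::finite \<Rightarrow> nat" and R :: "'i coeff mpoly" and p q :: nat
  assumes "2 \<le> CARD('i)"
    and "\<And>i. 2 \<le> \<alpha> i"
    and "is_refined_quiver_resultant \<alpha> R"
    and "p + q = CARD('i)" and "1 \<le> q"
  shows "\<exists>\<omega> :: 'i coeff \<Rightarrow> int.
           initial_form \<omega> R = phi \<alpha> p q \<or> initial_form \<omega> R = - phi \<alpha> p q"
proof -
  \<comment> \<open>\<open>e\<close> is the total sign of the factors dominated by their second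
    term; the ambiguity of sign in the claim absorbs it.\<close>
  define e where "e = (\<Prod>K::'i set | q < card K. face_sign \<alpha> K ^ (prod_pred \<alpha> K div lcm_pred \<alpha> K))"
  have "\<bar>e\<bar> = 1"
    by (simp add: e_def abs_prod power_abs face_sign_def)
  then have e: "e = 1 \<or> e = - 1" by linarith
  let ?\<omega> = "\<lambda>v. int (quiver_weight \<alpha> q v)"
  have "subst0 (B2 i) (quiver_res \<alpha>) \<noteq> 0" for i
    by (rule subst0_B2_quiver_res_nonzero[OF assms(2)])
  then have nz: "quiver_res \<alpha> \<noteq> 0" by (auto simp: subst0_def)
  have "initial_form ?\<omega> (quiver_res \<alpha>) = of_int e * phi \<alpha> p q"
  proof (rule initial_form_eqI[OF nz])
    show "of_int e * phi \<alpha> p q \<noteq> 0"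
      using e phi_nonzero[OF assms(2,4)] by auto
    show "finite (UNIV :: 'i coeff set)" by (rule finite_coeff)
    fix c :: "'i coeff \<Rightarrow> complex" assume c: "\<And>v. c v \<noteq> 0"
    obtain r where r: "\<And>i. bij_betw (r i) {1..<\<alpha> i} {w. w ^ (\<alpha> i - 1) = - c (B1 i) / c (B2 i)}"
      "\<And>i. r i 0 = - c (B0 i) / c (B1 i)"
      and lim: "(\<lambda>k. pencil_det \<alpha> (scale_point (quiver_weight \<alpha> q) k c) / of_nat k ^ (\<Sum>s\<in>idx \<alpha>. max q (card {i. s i \<noteq> 0})))
        \<longlonglongrightarrow> (\<Prod>i\<in>UNIV. c (B2 i) ^ (\<Prod>k\<in>UNIV - {i}. \<alpha> k)) *
        (\<Prod>s\<in>idx \<alpha>. (if card {i. s i \<noteq> 0} \<le> q then c A0 else 0) +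
          (if q \<le> card {i. s i \<noteq> 0} then c A1 * (\<Prod>i\<in>UNIV. r i (s i)) else 0))"
      by (rule pencil_det_scale_limit[of \<alpha> c q, OF assms(2) c]) (rule that)
    show "(\<lambda>k. mev (scale_point (quiver_weight \<alpha> q) k c) (quiver_res \<alpha>) / of_nat k ^ (\<Sum>s\<in>idx \<alpha>. max q (card {i. s i \<noteq> 0})))
        \<longlonglongrightarrow> mev c (of_int e * phi \<alpha> p q)"
      using lim unfolding limit_eq_phi[OF assms(2) c r assms(4,5)] e_def[symmetric]
      by (simp add: mev_quiver_res mev_mult mev.hom_of_int)
  qed
  then have "initial_form ?\<omega> R = phi \<alpha> p q \<or> initial_form ?\<omega> R = - phi \<alpha> p q"
    using refined_quiver_resultant_unique[OF assms(2,3)] e by (auto simp: initial_form_uminus)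
  then show ?thesis by blast
qed

end
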